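(* Let $X$ and $Y$ be complete separable (differentiable) manifolds equipped with Borel probability measures $\mu$ on $X$ and $\nu$ on $Y$. Let $c \in C^1(X \times Y)$ be a bounded cost function such that for each $y_1 \ne y_2 \in Y$, the map $$x \in X \longmapsto c(x,y_1) - c(x,y_2)$$ has no critical points, save at most one global minimum and at most one global maximum. Assume $d_x c(x,y)$ is locally bounded in $x$, uniformly in $y\in Y$. If $\mu$ is absolutely continuous with respect to coordinate measure on $X$, then the minimum $$\inf_{\gamma \in \Gamma(\mu,\nu)} \int_{X \times Y} c(x,y)\, d\gamma(x,y)$$ is uniquely attained; moreover, the minimizer $\gamma \in \Gamma(\mu,\nu)$ vanishes outside a numbered limb system in $X\times Y$ having at most two limbs.
   Context: $\Gamma(\mu,\nu)$ denotes the set of non-negative Borel measures on $X\times Y$ whose marginals (push-forwards under the projections to $X$ and $Y$) are $\mu$ and $\nu$ respectively. A measure $\gamma$ vanishes outside of $S\subset X\times Y$ if $\gamma$ assigns zero outer measure to $(X\times Y)\setminus S$. "Locally bounded in $x$, uniformly in $y \in Y$" means that each point of $X$ has a coordinate neighbourhood $U$ on which the magnitude of the $x$-derivative $d_xc(x,y)$ is bounded by a constant independent of $x\in U$ and $y\in Y$. Absolute continuity with respect to coordinate measure means absolute continuity with respect to Lebesgue measure in local coordinates on $X$. For a map $f$ defined on a set $D=\mathrm{Dom} f$, $\mathrm{Graph}(f)=\{(x,f(x)) : x\in D\}$, $\mathrm{Antigraph}(f)=\{(f(x),x) : x\in D\}$, and $\mathrm{Ran} f=f(D)$. A relation $S\subset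 X\times Y$ is a numbered limb system if there are countable disjoint decompositions $X=\bigcup_{i=0}^\infty I_{2i+1}$ and $Y=\bigcup_{i=0}^\infty I_{2i}$ (some $I_k$ may be empty), and a sequence of maps $f_{2i}:\mathrm{Dom}(f_{2i})\subset Y\to X$ and $f_{2i+1}:\mathrm{Dom}(f_{2i+1})\subset X\to Y$ ($i\ge 0$), such that $S=\bigcup_{i=1}^\infty \mathrm{Graph}(f_{2i-1})\cup \mathrm{Antigraph}(f_{2i})$, with $\mathrm{Dom}(f_k)\cup \mathrm{Ran}(f_{k+1})\subset I_k$ for each $k\ge 0$. (The map $f_0$ is irrelevant and may be taken to have empty domain.) The system has (at most) $N$ limbs if $\mathrm{Dom}(f_k)=\emptyset$ for all $k>N$. *)

theory Defs
  imports "HOL-Probability.Probability"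
begin

text \<open>
  A manifold is the whole of a topological type \<open>'a\<close> together with an atlas of charts
  \<open>(U, \<phi>)\<close>; the values of \<open>\<phi>\<close> outside \<open>U\<close> are irrelevant. The charts take values in a
  Euclidean space \<open>E\<close> of arbitrary dimension \<open>n \<ge> 0\<close>. Since every type of class
  \<open>euclidean_space\<close> has dimension at least 1, \<open>E = UNIV\<close> covers \<open>n \<ge> 1\<close>
  and \<open>E = {0}\<close> covers \<open>n = 0\<close> (countable discrete spaces).
\<close>

type_synonym ('a, 'e) chart = "'a set \<times> ('a \<Rightarrow> 'e)"

definition euclidean_model :: "'e::euclidean_space set \<Rightarrow> bool" where
  "euclidean_model E \<longleftrightarrow> E = UNIV \<or> E = {0}"

text \<open>Lebesgue measure on a model space; on the one-point space it is the unit point mass.\<close>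

definition model_measure :: "'e::euclidean_space set \<Rightarrow> 'e measure" where
  "model_measure E = (if E = UNIV then lborel else return borel 0)"

text \<open>
  Derivatives below are taken within the image of a chart. For an open image this is the usual
  derivative; for an image inside a proper subspace only the directions of that subspace matter,
  and on the one-point space the zero map is a derivative of every function.
\<close>

definition C1_on :: "'e::real_normed_vector set \<Rightarrow> ('e \<Rightarrow> 'f::real_normed_vector) \<Rightarrow> bool" where
  "C1_on S f \<longleftrightarrow> (\<exists>f' :: 'e \<Rightarrow> 'e \<Rightarrow>\<^sub>L 'f. continuous_on S f' \<and>
     (\<forall>x\<in>S. (f has_derivative blinfun_apply (f' x)) (at x within S)))"

definition is_chart ::
  "'e::euclidean_space set \<Rightarrow> ('a::topological_space, 'e) chart \<Rightarrow> bool" where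
  "is_chart E = (\<lambda>(U, \<phi>). open U \<and> openin (top_of_set E) (\<phi> ` U) \<and>
     homeomorphism U (\<phi> ` U) \<phi> (inv_into U \<phi>))"

definition C1_atlas ::
  "'e::euclidean_space set \<Rightarrow> ('a::topological_space, 'e) chart set \<Rightarrow> bool" where
  "C1_atlas E A \<longleftrightarrow> euclidean_model E \<and> (\<forall>ch\<in>A. is_chart E ch) \<and> (\<Union>(U, \<phi>)\<in>A. U) = UNIV \<and>
     (\<forall>(U, \<phi>)\<in>A. \<forall>(V, \<psi>)\<in>A. C1_on (\<phi> ` (U \<inter> V)) (\<psi> \<circ> inv_into U \<phi>))"

definition product_atlas ::
  "('a, 'e) chart set \<Rightarrow> ('b, 'f) chart set \<Rightarrow> ('a \<times> 'b, 'e \<times> 'f) chart set" where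
  "product_atlas A B = {(U \<times> V, map_prod \<phi> \<psi>) | U \<phi> V \<psi>. (U, \<phi>) \<in> A \<and> (V, \<psi>) \<in> B}"

definition C1_function ::
  "('a, 'e::real_normed_vector) chart set \<Rightarrow> ('a \<Rightarrow> real) \<Rightarrow> bool" where
  "C1_function A f \<longleftrightarrow> (\<forall>(U, \<phi>)\<in>A. C1_on (\<phi> ` U) (f \<circ> inv_into U \<phi>))"

definition has_chart_derivative ::
  "('a \<Rightarrow> real) \<Rightarrow> ('a, 'e::real_normed_vector) chart \<Rightarrow> 'a \<Rightarrow> ('e \<Rightarrow> real) \<Rightarrow> bool" where
  "has_chart_derivative f = (\<lambda>(U, \<phi>) x D.
     ((f \<circ> inv_into U \<phi>) has_derivative D) (at (\<phi> x) within \<phi> ` U))"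

definition critical_point ::
  "('a, 'e::real_normed_vector) chart set \<Rightarrow> ('a \<Rightarrow> real) \<Rightarrow> 'a \<Rightarrow> bool" where
  "critical_point A f x \<longleftrightarrow>
     (\<exists>(U, \<phi>)\<in>A. x \<in> U \<and> has_chart_derivative f (U, \<phi>) x (\<lambda>_. 0))"

definition no_critical_points_save_extrema ::
  "('a, 'e::real_normed_vector) chart set \<Rightarrow> ('a \<Rightarrow> real) \<Rightarrow> bool" where
  "no_critical_points_save_extrema A f \<longleftrightarrow>
     (\<forall>x. critical_point A f x \<longrightarrow> is_arg_min f (\<lambda>_. True) x \<or> is_arg_max f (\<lambda>_. True) x) \<and>
     (\<exists>\<^sub>\<le>\<^sub>1x. is_arg_min f (\<lambda>_. True) x) \<and>
     (\<exists>\<^sub>\<le>\<^sub>1x. is_arg_max f (\<lambda>_. True) x)"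

text \<open>The open set \<open>W\<close>, with the restriction of \<open>\<phi>\<close>, is the coordinate neighbourhood.\<close>

definition x_derivative_locally_bounded ::
  "('a::topological_space, 'e::real_normed_vector) chart set \<Rightarrow> ('a \<times> 'b \<Rightarrow> real) \<Rightarrow> bool" where
  "x_derivative_locally_bounded A c \<longleftrightarrow>
     (\<forall>x. \<exists>(U, \<phi>)\<in>A. \<exists>W K. open W \<and> x \<in> W \<and> W \<subseteq> U \<and>
        (\<forall>z\<in>W. \<forall>y. \<exists>D. has_chart_derivative (\<lambda>x. c (x, y)) (U, \<phi>) z D \<and> onorm D \<le> K))"

definition ac_coordinate_measure ::
  "'e::euclidean_space set \<Rightarrow> ('a::topological_space, 'e) chart set \<Rightarrow> 'a measure \<Rightarrow> bool" where
  "ac_coordinate_measure E A \<mu> \<longleftrightarrow>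
     (\<forall>(U, \<phi>)\<in>A. absolutely_continuous (model_measure E) (distr (restrict_space \<mu> U) borel \<phi>))"

definition couplings ::
  "'a::topological_space measure \<Rightarrow> 'b::topological_space measure \<Rightarrow> ('a \<times> 'b) measure set" where
  "couplings \<mu> \<nu> = {\<gamma>. sets \<gamma> = sets borel \<and> distr \<gamma> borel fst = \<mu> \<and> distr \<gamma> borel snd = \<nu>}"

definition vanishes_outside :: "'a measure \<Rightarrow> 'a set \<Rightarrow> bool" where
  "vanishes_outside \<gamma> S \<longleftrightarrow> outer_measure_of \<gamma> (space \<gamma> - S) = 0"

text \<open>
  In a numbered limb system, sets and maps with even and with odd index have different types, so
  the two families are listed separately: \<open>Ieven i\<close> and \<open>feven i\<close> stand for index \<open>2i\<close>, while
  \<open>Iodd i\<close> and \<open>fodd i\<close> stand for index \<open>2i+1\<close>. The map \<open>feven 0\<close> does not contribute to \<open>S\<close>.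
\<close>

definition numbered_limb_system_by ::
  "(nat \<Rightarrow> 'b set) \<Rightarrow> (nat \<Rightarrow> 'a set) \<Rightarrow> (nat \<Rightarrow> 'b \<rightharpoonup> 'a) \<Rightarrow> (nat \<Rightarrow> 'a \<rightharpoonup> 'b)
    \<Rightarrow> ('a \<times> 'b) set \<Rightarrow> bool" where
  "numbered_limb_system_by Ieven Iodd feven fodd S \<longleftrightarrow>
     disjoint_family Iodd \<and> (\<Union>i. Iodd i) = UNIV \<and>
     disjoint_family Ieven \<and> (\<Union>i. Ieven i) = UNIV \<and>
     S = (\<Union>i. Map.graph (fodd i)) \<union> (\<Union>i\<in>{1..}. (Map.graph (feven i))\<inverse>) \<and>
     (\<forall>i. dom (feven i) \<union> ran (fodd i) \<subseteq> Ieven i) \<and>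
     (\<forall>i. dom (fodd i) \<union> ran (feven (Suc i)) \<subseteq> Iodd i)"

definition at_most_limbs :: "nat \<Rightarrow> (nat \<Rightarrow> 'b \<rightharpoonup> 'a) \<Rightarrow> (nat \<Rightarrow> 'a \<rightharpoonup> 'b) \<Rightarrow> bool" where
  "at_most_limbs N feven fodd \<longleftrightarrow>
     (\<forall>i. 2 * i > N \<longrightarrow> dom (feven i) = {}) \<and> (\<forall>i. 2 * i + 1 > N \<longrightarrow> dom (fodd i) = {})"

definition numbered_limb_system :: "nat \<Rightarrow> ('a \<times> 'b) set \<Rightarrow> bool" where
  "numbered_limb_system N S \<longleftrightarrow> (\<exists>Ieven Iodd feven fodd.
     numbered_limb_system_by Ieven Iodd feven fodd S \<and> at_most_limbs N feven fodd)"

end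

theory Submission
  imports Defs
begin

text \<open>
  Exchanging partners in two independent draws from an optimal coupling shows that its support is
  2-monotone for \<open>c\<close>. This replaces the dual potentials: if a point \<open>x\<close> has two partners with
  different slopes of \<open>c (\<cdot>, y)\<close> in a coordinate direction, 2-monotonicity keeps such points with a
  fixed rational gap between the slopes apart from their small translates, so these points are
  Lebesgue null. Outside this null set \<open>x\<close> is a critical point, hence an extremum, of
  \<open>c (\<cdot>, y1) - c (\<cdot>, y2)\<close> for any two of its partners, and 2-monotonicity then leaves \<open>x\<close> as the only
  partner of one of the two. So every \<open>x\<close> has at most one partner that is shared with other points,
  which gives the two limbs. Marginals determine a coupling on such a set; applied to the average
  of two minimizers this yields uniqueness. Working with \<open>\<sigma>\<close>-compact sets keeps all projections
  measurable. For existence, a cluster point of a minimizing sequence, taken setwise, is finitely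
  additive, and tightness of the marginals makes it extend to a measure.
\<close>

section \<open>Sigma-compact sets\<close>

text \<open>Exchanging two partners suffices, with no longer cycles, because every later use
  compares two edges only: the slope argument takes edges over \<open>p\<close> and
  \<open>p + t *\<^sub>R e\<close>, the extremum argument one edge at \<open>x\<close> and one
  elsewhere. The exceptional set of points \<open>x\<close> is merely Borel, so removing the strip
  over it may destroy sigma-compactness; inner regularity restores it, and monotonicity and
  criticality pass to subsets. Each minimizer comes with a carrier of its own. The average of two
  minimizers is again a minimizer and both are absolutely continuous with respect to it, so its
  carrier serves for both. In the existence part the cluster point is taken on all sets at once,
  that is on uncountably many coordinates, so countable additivity is lost. The measure built from
  it agrees with it only on the ring of rectangles. On open sets it can only be smaller, which is
  exactly the inequality behind lower semicontinuity of the cost.\<close>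

definition sigma_compact :: "'a::topological_space set \<Rightarrow> bool" where
  "sigma_compact S \<longleftrightarrow> (\<exists>\<K>. countable \<K> \<and> (\<forall>K\<in>\<K>. compact K) \<and> S = \<Union>\<K>)"

lemma sigma_compactI:
  assumes "countable \<K>" "\<And>K. K \<in> \<K> \<Longrightarrow> compact K" "S = \<Union>\<K>"
  shows "sigma_compact S"
  using assms unfolding sigma_compact_def by blast

lemma sigma_compact_UN:
  assumes I: "countable I" and S: "\<And>i. i \<in> I \<Longrightarrow> sigma_compact (S i)"
  shows "sigma_compact (\<Union>i\<in>I. S i)"
proof -
  have "\<forall>i\<in>I. \<exists>\<K>. countable \<K> \<and> (\<forall>K\<in>\<K>. compact K) \<and> S i = \<Union>\<K>"
    using S unfolding sigma_compact_def by blast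
  then obtain \<K> where K: "\<forall>i\<in>I. countable (\<K> i) \<and> (\<forall>K\<in>\<K> i. compact K) \<and> S i = \<Union>(\<K> i)"
    by metis
  show ?thesis
    by (rule sigma_compactI[of "\<Union>i\<in>I. \<K> i"]) (use I K in auto)
qed

lemma sigma_compact_image:
  assumes "sigma_compact S" "continuous_on S f"
  shows "sigma_compact (f ` S)"
proof -
  obtain \<K> where K: "countable \<K>" "\<And>K. K \<in> \<K> \<Longrightarrow> compact K" "S = \<Union>\<K>"
    using assms(1) unfolding sigma_compact_def by blast
  have "compact (f ` K)" if "K \<in> \<K>" for K
    using that K assms(2) by (intro compact_continuous_image continuous_on_subset[OF assms(2)]) auto
  then show ?thesis
    by (intro sigma_compactI[of "(`) f ` \<K>"]) (use K in auto)
qed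

lemma sigma_compact_Int_closed:
  assumes "sigma_compact S" "closed C"
  shows "sigma_compact (S \<inter> C)"
proof -
  obtain \<K> where K: "countable \<K>" "\<And>K. K \<in> \<K> \<Longrightarrow> compact K" "S = \<Union>\<K>"
    using assms(1) unfolding sigma_compact_def by blast
  then show ?thesis
    by (intro sigma_compactI[of "(\<lambda>K. K \<inter> C) ` \<K>"]) (use assms(2) in \<open>auto intro: compact_Int_closed\<close>)
qed

lemma sigma_compact_Times:
  assumes "sigma_compact S" "sigma_compact T"
  shows "sigma_compact (S \<times> T)"
proof -
  obtain \<K> where K: "countable \<K>" "\<And>K. K \<in> \<K> \<Longrightarrow> compact K" "S = \<Union>\<K>"
    using assms(1) unfolding sigma_compact_def by blast
  obtain \<L> where L: "countable \<L>" "\<And>K. K \<in> \<L> \<Longrightarrow> compact K" "T = \<Union>\<L>"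
    using assms(2) unfolding sigma_compact_def by blast
  show ?thesis
    by (rule sigma_compactI[of "(\<lambda>(K, L). K \<times> L) ` (\<K> \<times> \<L>)"])
       (use K L in \<open>auto intro: compact_Times\<close>)
qed

lemma sigma_compact_Int:
  fixes S T :: "'a::t2_space set"
  assumes "sigma_compact S" "sigma_compact T"
  shows "sigma_compact (S \<inter> T)"
proof -
  obtain \<K> where K: "countable \<K>" "\<And>K. K \<in> \<K> \<Longrightarrow> compact K" "S = \<Union>\<K>"
    using assms(1) unfolding sigma_compact_def by blast
  obtain \<L> where L: "countable \<L>" "\<And>K. K \<in> \<L> \<Longrightarrow> compact K" "T = \<Union>\<L>"
    using assms(2) unfolding sigma_compact_def by blast
  show ?thesis
    by (rule sigma_compactI[of "(\<lambda>(K, L). K \<inter> L) ` (\<K> \<times> \<L>)"])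
       (use K L in \<open>auto intro: compact_Int\<close>)
qed

lemma sigma_compact_borel:
  fixes S :: "'a::t2_space set"
  assumes "sigma_compact S"
  shows "S \<in> sets borel"
proof -
  obtain \<K> where K: "countable \<K>" "\<And>K. K \<in> \<K> \<Longrightarrow> compact K" "S = \<Union>\<K>"
    using assms unfolding sigma_compact_def by blast
  then show ?thesis
    by (auto intro!: sets.countable_Union simp: borel_closed compact_imp_closed subset_eq)
qed

text \<open>Inner regularity in epsilon form: finiteness of the measure makes adding
  \<open>e\<close> a strict increase, so some compact subset comes within \<open>e\<close> of the
  supremum.\<close>

lemma ex_compact_measure_Diff_less:
  fixes M :: "'a::{second_countable_topology, complete_space} measure"
  assumes "finite_measure M" and sets: "sets M = sets borel" and D: "D \<in> sets borel" and e: "e > 0"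
  obtains K where "K \<subseteq> D" "compact K" "measure M (D - K) < e"
proof -
  interpret finite_measure M by fact
  have reg: "emeasure M D = (SUP K \<in> {K. K \<subseteq> D \<and> compact K}. emeasure M K)"
    by (rule inner_regular[OF sets _ D]) simp
  have "emeasure M D < (SUP K \<in> {K. K \<subseteq> D \<and> compact K}. emeasure M K) + ennreal e"
    unfolding reg[symmetric] using e
    by (simp add: emeasure_eq_measure ennreal_plus[symmetric] ennreal_less_iff del: ennreal_plus)
  then have "emeasure M D < (SUP K \<in> {K. K \<subseteq> D \<and> compact K}. emeasure M K + ennreal e)"
    by (subst ennreal_SUP_add_left) auto
  then obtain K where K: "K \<subseteq> D" "compact K" "emeasure M D < emeasure M K + ennreal e"
    unfolding less_SUP_iff by auto
  then have "measure M D < measure M K + e"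
    using e by (simp add: emeasure_eq_measure ennreal_plus[symmetric] ennreal_less_iff del: ennreal_plus)
  moreover have "measure M (D - K) = measure M D - measure M K"
    using D K by (intro finite_measure_Diff) (auto simp: sets borel_closed compact_imp_closed)
  ultimately show ?thesis using K by (intro that[of K]) auto
qed

text \<open>A Borel or closed subset of a Polish space need not be sigma-compact. This is how a
  carrier is cut down to a sigma-compact one at the price of a null set.\<close>

lemma ex_sigma_compact_full_measure:
  fixes M :: "'a::{second_countable_topology, complete_space} measure"
  assumes M: "finite_measure M" and sets: "sets M = sets borel" and D: "D \<in> sets borel"
  obtains S where "S \<subseteq> D" "sigma_compact S" "emeasure M (D - S) = 0"
proof -
  interpret finite_measure M by fact
  have "\<exists>K. K \<subseteq> D \<and> compact K \<and> measure M (D - K) < inverse (real (Suc n))" for n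
    using ex_compact_measure_Diff_less[OF M sets D, of "inverse (real (Suc n))"] by fastforce
  then obtain K where K: "\<And>n. K n \<subseteq> D" "\<And>n. compact (K n)" "\<And>n. measure M (D - K n) < inverse (real (Suc n))"
    by metis
  define S where "S = (\<Union>n. K n)"
  have S: "sigma_compact S"
    unfolding S_def by (rule sigma_compactI[of "range K"]) (use K in auto)
  have "measure M (D - S) \<le> inverse (real (Suc n))" for n
  proof -
    have "K n \<in> sets M" unfolding sets by (intro borel_closed compact_imp_closed K)
    then have "measure M (D - S) \<le> measure M (D - K n)"
      using D by (intro finite_measure_mono) (auto simp: S_def sets)
    then show ?thesis using K(3)[of n] by simp
  qed
  then have "measure M (D - S) \<le> 0"
    using LIMSEQ_le_const[OF LIMSEQ_inverse_real_of_nat] by blast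
  then have "emeasure M (D - S) = 0"
    by (simp add: emeasure_eq_measure measure_le_0_iff)
  with S K show ?thesis
    by (intro that[of S]) (auto simp: S_def)
qed

section \<open>Couplings carried by a two-limb system\<close>

text \<open>With \<open>S\<close> read as the edge set of a bipartite graph, these are the vertices
  \<open>y\<close> of degree at least two.\<close>

definition multi_partnered :: "('a \<times> 'b) set \<Rightarrow> 'b set" where
  "multi_partnered S = {y. \<exists>x x'. x \<noteq> x' \<and> (x, y) \<in> S \<and> (x', y) \<in> S}"

text \<open>Every edge then either leads from \<open>x\<close> to its only partner of degree at
  least two or ends in a \<open>y\<close> of degree one: the graph of a function of \<open>x\<close>
  and the antigraph of a function of \<open>y\<close>.\<close>

definition limb_like :: "('a \<times> 'b) set \<Rightarrow> bool" where
  "limb_like S \<longleftrightarrow> (\<forall>x. \<exists>\<^sub>\<le>\<^sub>1y. (x, y) \<in> S \<and> y \<in> multi_partnered S)"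

lemma multi_partnered_other_vertex:
  assumes "y \<in> multi_partnered S"
  shows "\<exists>x'. x' \<noteq> x \<and> (x', y) \<in> S"
proof -
  obtain a b where "a \<noteq> b" "(a, y) \<in> S" "(b, y) \<in> S" using assms unfolding multi_partnered_def by auto
  then show ?thesis by (cases "a = x") auto
qed

text \<open>The condition \<open>x \<noteq> x'\<close> is not closed, so it is exhausted by the
  closed conditions \<open>1 / Suc n \<le> dist x x'\<close>. Each cuts out a sigma-compact set of
  pairs of edges, and projecting to the common \<open>y\<close> preserves this.\<close>

lemma sigma_compact_multi_partnered:
  fixes S :: "('a::metric_space \<times> 'b::t2_space) set"
  assumes "sigma_compact S"
  shows "sigma_compact (multi_partnered S)"
proof -
  let ?C = "\<lambda>n::nat. {z::('a \<times> 'b) \<times> ('a \<times> 'b). snd (fst z) = snd (snd z) \<and> 1 / Suc n \<le> dist (fst (fst z)) (fst (snd z))}"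
  have closed: "closed (?C n)" for n
    by (intro closed_Collect_conj closed_Collect_eq closed_Collect_le continuous_intros)
  have eq: "multi_partnered S = (\<Union>n. (\<lambda>z. snd (fst z)) ` ((S \<times> S) \<inter> ?C n))"
  proof (rule set_eqI, rule iffI)
    fix y assume "y \<in> multi_partnered S"
    then obtain x x' where x: "x \<noteq> x'" "(x, y) \<in> S" "(x', y) \<in> S" unfolding multi_partnered_def by blast
    obtain n where "inverse (real (Suc n)) < dist x x'" using reals_Archimedean x by (metis zero_less_dist_iff)
    with x show "y \<in> (\<Union>n. (\<lambda>z. snd (fst z)) ` ((S \<times> S) \<inter> ?C n))"
      by (intro UN_I[of n] image_eqI[of _ _ "((x, y), (x', y))"]) (auto simp: inverse_eq_divide)
  next
    fix y assume "y \<in> (\<Union>n. (\<lambda>z. snd (fst z)) ` ((S \<times> S) \<inter> ?C n))"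
    then obtain n x x' where "(x, y) \<in> S" "(x', y) \<in> S" "1 / Suc n \<le> dist x x'" by auto
    moreover have "0 < 1 / real (Suc n)" by simp
    ultimately have "x \<noteq> x'" by (metis dist_self not_le)
    then show "y \<in> multi_partnered S" using \<open>(x, y) \<in> S\<close> \<open>(x', y) \<in> S\<close> unfolding multi_partnered_def by blast
  qed
  show ?thesis unfolding eq
    by (intro sigma_compact_UN sigma_compact_image sigma_compact_Int_closed sigma_compact_Times
        assms closed continuous_intros) auto
qed

section \<open>Marginals and total mass of couplings\<close>

lemma couplings_space:
  assumes "\<gamma> \<in> couplings \<mu> \<nu>"
  shows "sets \<gamma> = sets borel" "space \<gamma> = UNIV" "distr \<gamma> borel fst = \<mu>" "distr \<gamma> borel snd = \<nu>"
  using assms sets_eq_imp_space_eq[of \<gamma> borel] unfolding couplings_def by auto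

lemma couplings_fst_snd_measurable:
  fixes \<gamma> :: "('a::topological_space \<times> 'b::topological_space) measure"
  assumes "\<gamma> \<in> couplings \<mu> \<nu>"
  shows "fst \<in> measurable \<gamma> borel" "snd \<in> measurable \<gamma> borel"
proof -
  show "fst \<in> measurable \<gamma> borel" "snd \<in> measurable \<gamma> borel"
    unfolding measurable_cong_sets[OF couplings_space(1)[OF assms] refl]
    by (rule borel_measurable_continuous_onI[OF continuous_on_fst[OF continuous_on_id]]
          borel_measurable_continuous_onI[OF continuous_on_snd[OF continuous_on_id]])+
qed

lemma couplings_emeasure:
  assumes "\<gamma> \<in> couplings \<mu> \<nu>"
  shows "A \<in> sets borel \<Longrightarrow> emeasure \<gamma> (A \<times> UNIV) = emeasure \<mu> A"
    and "B \<in> sets borel \<Longrightarrow> emeasure \<gamma> (UNIV \<times> B) = emeasure \<nu> B"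
proof -
  note m = couplings_fst_snd_measurable[OF assms] and s = couplings_space[OF assms]
  show "emeasure \<gamma> (A \<times> UNIV) = emeasure \<mu> A" if "A \<in> sets borel"
    unfolding s(3)[symmetric] using that
    by (subst emeasure_distr[OF m(1)]) (auto intro!: arg_cong[where f="emeasure \<gamma>"] simp: s)
  show "emeasure \<gamma> (UNIV \<times> B) = emeasure \<nu> B" if "B \<in> sets borel"
    unfolding s(4)[symmetric] using that
    by (subst emeasure_distr[OF m(2)]) (auto intro!: arg_cong[where f="emeasure \<gamma>"] simp: s)
qed

lemma couplings_prob_space:
  assumes "\<gamma> \<in> couplings \<mu> \<nu>" "prob_space \<mu>"
  shows "prob_space \<gamma>"
  using couplings_space[OF assms(1)] couplings_emeasure(1)[OF assms(1), of UNIV]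
    prob_space.emeasure_space_1[OF assms(2)]
  by (intro prob_spaceI) (metis sets.top space_borel space_distr UNIV_Times_UNIV)

text \<open>
  The mass of \<open>S\<close> over vertices \<open>y\<close> of degree one is read off from \<open>\<nu>\<close>; over the remaining
  \<open>y\<close> the set \<open>S\<close> is the graph of a function of \<open>x\<close>, so the mass there is read off from what is
  left of \<open>\<mu>\<close>.
\<close>

lemma coupling_on_limbs_emeasure:
  fixes \<gamma> :: "('a::polish_space \<times> 'b::polish_space) measure"
  assumes \<gamma>: "\<gamma> \<in> couplings \<mu> \<nu>" and \<mu>: "prob_space \<mu>"
    and S: "sigma_compact S" "limb_like S" and null: "emeasure \<gamma> (- S) = 0"
    and C: "closed C"
  defines "D \<equiv> multi_partnered S"
  defines "P \<equiv> fst ` (S \<inter> C \<inter> (UNIV \<times> D))"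
  shows "emeasure \<gamma> C = emeasure \<nu> (snd ` (S \<inter> C) - D) +
    (emeasure \<mu> P - emeasure \<nu> (snd ` (S \<inter> (P \<times> UNIV)) - D))"
proof -
  note s = couplings_space[OF \<gamma>]
  interpret prob_space \<gamma> by (rule couplings_prob_space[OF \<gamma> \<mu>])
  have D: "sigma_compact D" unfolding D_def by (rule sigma_compact_multi_partnered[OF S(1)])
  have snd_sc: "sigma_compact (snd ` Q)" and fst_sc: "sigma_compact (fst ` Q)"
    if "sigma_compact Q" for Q :: "('a \<times> 'b) set"
    using that continuous_on_fst[OF continuous_on_id] continuous_on_snd[OF continuous_on_id]
    by (auto intro: sigma_compact_image)
  have Sb: "S \<in> sets \<gamma>" unfolding s by (rule sigma_compact_borel[OF S(1)])
  have restr: "emeasure \<gamma> Q = emeasure \<gamma> (S \<inter> Q)" if "Q \<in> sets borel" for Q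
  proof -
    have "emeasure \<gamma> Q = emeasure \<gamma> (Q - (- S))"
      using that Sb null by (intro emeasure_Diff_null_set[symmetric]) (auto simp: s null_sets_def Compl_eq_Diff_UNIV)
    also have "Q - (- S) = S \<inter> Q" by auto
    finally show ?thesis .
  qed
  have Dx: "UNIV \<times> D \<in> sets borel" "UNIV \<times> (-D) \<in> sets borel" for Q
    using sigma_compact_borel[OF D] by (auto intro!: borel_Times)
  have part1: "emeasure \<gamma> (S \<inter> Q \<inter> (UNIV \<times> (-D))) = emeasure \<nu> (snd ` (S \<inter> Q) - D)"
    if Q: "sigma_compact (S \<inter> Q)" for Q
  proof -
    have b: "snd ` (S \<inter> Q) - D \<in> sets borel"
      using sigma_compact_borel[OF snd_sc[OF Q]] sigma_compact_borel[OF D] by auto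
    have "emeasure \<nu> (snd ` (S \<inter> Q) - D) = emeasure \<gamma> (UNIV \<times> (snd ` (S \<inter> Q) - D))"
      by (rule couplings_emeasure(2)[OF \<gamma> b, symmetric])
    also have "\<dots> = emeasure \<gamma> (S \<inter> (UNIV \<times> (snd ` (S \<inter> Q) - D)))"
      using b by (intro restr borel_Times) auto
    \<comment> \<open>A \<open>y\<close> outside \<open>D\<close> has a single edge in
      \<open>S\<close>, so that edge lies in \<open>Q\<close> as soon as some edge over
      \<open>y\<close> does.\<close>
    also have "S \<inter> (UNIV \<times> (snd ` (S \<inter> Q) - D)) = S \<inter> Q \<inter> (UNIV \<times> (-D))"
    proof (rule set_eqI, clarify, rule iffI)
      fix x y assume *: "(x, y) \<in> S \<inter> (UNIV \<times> (snd ` (S \<inter> Q) - D))"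
      then obtain x' where x': "(x', y) \<in> S \<inter> Q" by auto
      with * have "x' = x" unfolding D_def multi_partnered_def by auto
      then show "(x, y) \<in> S \<inter> Q \<inter> (UNIV \<times> (-D))" using * x' by auto
    next
      fix x y assume "(x, y) \<in> S \<inter> Q \<inter> (UNIV \<times> (-D))"
      then show "(x, y) \<in> S \<inter> (UNIV \<times> (snd ` (S \<inter> Q) - D))" by force
    qed
    finally show ?thesis ..
  qed
  have SC: "sigma_compact (S \<inter> C)" using S C by (intro sigma_compact_Int_closed)
  \<comment> \<open>\<open>UNIV\<close> is not known to be sigma-compact; the projection of
    \<open>S\<close> can stand in for it.\<close>
  have "S \<inter> C \<inter> (UNIV \<times> D) = S \<inter> C \<inter> (fst ` S \<times> D)" by force
  then have "sigma_compact (S \<inter> C \<inter> (UNIV \<times> D))"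
    using sigma_compact_Int[OF SC sigma_compact_Times[OF fst_sc[OF S(1)] D]] by simp
  then have P: "sigma_compact P" unfolding P_def by (rule fst_sc)
  have Pb: "P \<in> sets borel" by (rule sigma_compact_borel[OF P])
  have "S \<inter> (P \<times> UNIV) = S \<inter> (P \<times> snd ` S)" by force
  then have SP: "sigma_compact (S \<inter> (P \<times> UNIV))"
    using sigma_compact_Int[OF S(1) sigma_compact_Times[OF P snd_sc[OF S(1)]]] by simp
  have split: "emeasure \<gamma> (S \<inter> Q) = emeasure \<gamma> (S \<inter> Q \<inter> (UNIV \<times> (-D))) + emeasure \<gamma> (S \<inter> Q \<inter> (UNIV \<times> D))"
    if "sigma_compact (S \<inter> Q)" for Q
  proof -
    have "S \<inter> Q \<in> sets \<gamma>" unfolding s by (rule sigma_compact_borel[OF that])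
    then show ?thesis using Dx
      by (subst plus_emeasure) (auto simp: s intro!: arg_cong[where f="emeasure \<gamma>"])
  qed
  \<comment> \<open>Each \<open>x\<close> has at most one edge into \<open>D\<close>. For
    \<open>x \<in> P\<close> this edge is the one in \<open>C\<close>, so a condition on edges
    becomes one on \<open>x\<close> alone, which \<mu> can see.\<close>
  have graph: "S \<inter> C \<inter> (UNIV \<times> D) = S \<inter> (P \<times> UNIV) \<inter> (UNIV \<times> D)"
  proof (rule set_eqI, clarify, rule iffI)
    fix x y assume "(x, y) \<in> S \<inter> C \<inter> (UNIV \<times> D)"
    then show "(x, y) \<in> S \<inter> (P \<times> UNIV) \<inter> (UNIV \<times> D)" unfolding P_def by force
  next
    fix x y assume *: "(x, y) \<in> S \<inter> (P \<times> UNIV) \<inter> (UNIV \<times> D)"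
    then obtain y' where y': "(x, y') \<in> S \<inter> C \<inter> (UNIV \<times> D)" unfolding P_def by auto
    with * have "y' = y"
      using Uniq_D[of "\<lambda>y. (x, y) \<in> S \<and> y \<in> multi_partnered S" y y'] S(2) unfolding limb_like_def D_def by auto
    then show "(x, y) \<in> S \<inter> C \<inter> (UNIV \<times> D)" using y' by simp
  qed
  have "emeasure \<mu> P = emeasure \<gamma> (S \<inter> (P \<times> UNIV))"
    using Pb by (subst couplings_emeasure(1)[OF \<gamma> Pb, symmetric]) (auto intro!: restr borel_Times)
  also have "\<dots> = emeasure \<nu> (snd ` (S \<inter> (P \<times> UNIV)) - D) + emeasure \<gamma> (S \<inter> C \<inter> (UNIV \<times> D))"
    unfolding split[OF SP] part1[OF SP] graph ..
  \<comment> \<open>The mass over \<open>D\<close> is what remains of \<mu> on \<open>P\<close>; the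
    subtraction in \<open>ennreal\<close> is legitimate because the subtracted mass is
    finite.\<close>
  finally have "emeasure \<mu> P - emeasure \<nu> (snd ` (S \<inter> (P \<times> UNIV)) - D) = emeasure \<gamma> (S \<inter> C \<inter> (UNIV \<times> D))"
    using part1[OF SP] emeasure_finite[of "S \<inter> (P \<times> UNIV) \<inter> (UNIV \<times> (-D))"] by auto
  moreover have "emeasure \<gamma> C = emeasure \<nu> (snd ` (S \<inter> C) - D) + emeasure \<gamma> (S \<inter> C \<inter> (UNIV \<times> D))"
    using C by (subst restr) (auto simp: split[OF SC] part1[OF SC])
  ultimately show ?thesis by simp
qed

text \<open>The formula for closed sets involves the coupling only through its marginals, and the
  closed sets are an intersection-stable generator of the Borel sets.\<close>

lemma coupling_on_limbs_unique:
  fixes \<gamma> \<gamma>' :: "('a::polish_space \<times> 'b::polish_space) measure"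
  assumes "\<gamma> \<in> couplings \<mu> \<nu>" "\<gamma>' \<in> couplings \<mu> \<nu>" "prob_space \<mu>"
    and "sigma_compact S" "limb_like S" "emeasure \<gamma> (- S) = 0" "emeasure \<gamma>' (- S) = 0"
  shows "\<gamma> = \<gamma>'"
proof (rule measure_eqI_generator_eq[where \<Omega>=UNIV and E="{C. closed C}" and A="\<lambda>_::nat. UNIV"])
  interpret prob_space \<gamma> by (rule couplings_prob_space[OF assms(1,3)])
  show "sets \<gamma> = sigma_sets UNIV {C. closed C}" "sets \<gamma>' = sigma_sets UNIV {C. closed C}"
    using assms(1,2) by (simp_all add: couplings_space borel_eq_closed)
  show "emeasure \<gamma> UNIV \<noteq> \<infinity>" by simp
  show "emeasure \<gamma> C = emeasure \<gamma>' C" if "C \<in> {C. closed C}" for C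
    using that assms by (simp add: coupling_on_limbs_emeasure)
qed (auto simp: Int_stable_def)

text \<open>The first limb sends \<open>x\<close> to its partner of degree at least two, the second
  sends each \<open>y\<close> of degree one to its only partner. Thus the index 0 set holds the
  \<open>y\<close> of higher degree, index 2 all other \<open>y\<close>, and index 1 the whole of X;
  in the split families \<open>fodd 0\<close> has index 1 and \<open>feven 1\<close> has index
  2.\<close>

lemma limb_like_numbered_limb_system:
  assumes "limb_like S"
  shows "numbered_limb_system 2 S"
proof -
  define f1 where "f1 x = (if \<exists>y. (x, y) \<in> S \<and> y \<in> multi_partnered S then Some (THE y. (x, y) \<in> S \<and> y \<in> multi_partnered S) else None)" for x
  define f2 where "f2 y = (if y \<notin> multi_partnered S \<and> y \<in> snd ` S then Some (THE x. (x, y) \<in> S) else None)" for y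
  have f1: "f1 x = Some y \<longleftrightarrow> (x, y) \<in> S \<and> y \<in> multi_partnered S" for x y
  proof -
    have uniq: "\<exists>\<^sub>\<le>\<^sub>1y. (x, y) \<in> S \<and> y \<in> multi_partnered S" using assms unfolding limb_like_def by blast
    have "(THE y. (x, y) \<in> S \<and> y \<in> multi_partnered S) = z" if "(x, z) \<in> S" "z \<in> multi_partnered S" for z
      using the1_equality'[OF uniq] that by blast
    then show ?thesis unfolding f1_def by auto
  qed
  have f2: "f2 y = Some x \<longleftrightarrow> (x, y) \<in> S \<and> y \<notin> multi_partnered S" for x y
  proof -
    have "(THE x. (x, y) \<in> S) = z" if "y \<notin> multi_partnered S" "(z, y) \<in> S" for z
      using that unfolding multi_partnered_def by (intro the_equality) auto
    then show ?thesis unfolding f2_def by force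
  qed
  define fodd where "fodd i = (if i = 0 then f1 else Map.empty)" for i :: nat
  define feven where "feven i = (if i = 1 then f2 else Map.empty)" for i :: nat
  define Iodd where "Iodd i = (if i = 0 then UNIV else {}::'a set)" for i :: nat
  define Ieven where "Ieven i = (if i = 0 then multi_partnered S else if i = 1 then - multi_partnered S else {})" for i :: nat
  have "S = (\<Union>i. Map.graph (fodd i)) \<union> (\<Union>i\<in>{1..}. (Map.graph (feven i))\<inverse>)"
  proof (rule set_eqI, clarify)
    fix x y
    have "(x, y) \<in> (\<Union>i. Map.graph (fodd i)) \<longleftrightarrow> (x, y) \<in> S \<and> y \<in> multi_partnered S"
      by (auto simp: fodd_def f1 in_graphD dest!: in_graphD split: if_splits intro!: exI[of _ 0] in_graphI)
    moreover have "(x, y) \<in> (\<Union>i\<in>{1..}. (Map.graph (feven i))\<inverse>) \<longleftrightarrow> (x, y) \<in> S \<and> y \<notin> multi_partnered S"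
      by (auto simp: feven_def f2 in_graphD dest!: in_graphD split: if_splits intro!: bexI[of _ 1] in_graphI)
    ultimately show "(x, y) \<in> S \<longleftrightarrow> (x, y) \<in> (\<Union>i. Map.graph (fodd i)) \<union> (\<Union>i\<in>{1..}. (Map.graph (feven i))\<inverse>)"
      by blast
  qed
  moreover have "disjoint_family Iodd" "(\<Union>i. Iodd i) = UNIV" "disjoint_family Ieven" "(\<Union>i. Ieven i) = UNIV"
    by (auto simp: disjoint_family_on_def Iodd_def Ieven_def split: if_splits)
  moreover have "dom (feven i) \<union> ran (fodd i) \<subseteq> Ieven i" "dom (fodd i) \<union> ran (feven (Suc i)) \<subseteq> Iodd i" for i
    by (auto simp: feven_def fodd_def Ieven_def Iodd_def ran_def f1 f2 split: if_splits)
  ultimately have "numbered_limb_system_by Ieven Iodd feven fodd S"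
    unfolding numbered_limb_system_by_def by blast
  moreover have "at_most_limbs 2 feven fodd"
    unfolding at_most_limbs_def feven_def fodd_def by auto
  ultimately show ?thesis unfolding numbered_limb_system_def by blast
qed

section \<open>Monotone sets and non-differentiability points\<close>

text \<open>This is c-cyclical monotonicity restricted to cycles of length two.\<close>

definition cost_monotone :: "('a \<times> 'b \<Rightarrow> real) \<Rightarrow> ('a \<times> 'b) set \<Rightarrow> bool" where
  "cost_monotone c S \<longleftrightarrow> (\<forall>x y x' y'. (x, y) \<in> S \<longrightarrow> (x', y') \<in> S \<longrightarrow> c (x, y) + c (x', y') \<le> c (x, y') + c (x', y))"

lemma cost_monotoneD: "cost_monotone c S \<Longrightarrow> (x, y) \<in> S \<Longrightarrow> (x', y') \<in> S \<Longrightarrow> c (x, y) + c (x', y') \<le> c (x, y') + c (x', y)"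
  unfolding cost_monotone_def by blast

lemma cost_monotone_subset: "cost_monotone c S \<Longrightarrow> T \<subseteq> S \<Longrightarrow> cost_monotone c T"
  unfolding cost_monotone_def by blast

text \<open>Infinitely many disjoint translates of \<open>N\<close> by multiples of \<open>e\<close> fit into a bounded set.\<close>

lemma null_if_disjoint_translates:
  fixes N :: "'e::euclidean_space set"
  assumes N: "N \<in> sets borel" "bounded N" and \<delta>: "\<delta> > 0"
    and sep: "\<And>x t. x \<in> N \<Longrightarrow> 0 < t \<Longrightarrow> t < \<delta> \<Longrightarrow> x + t *\<^sub>R e \<notin> N"
  shows "N \<in> null_sets lborel"
proof -
  \<comment> \<open>Only three properties matter: the shifts are distinct, positive and below
    \<delta>, so the difference of two of them is up to sign again in the range of
    \<open>sep\<close>. The summand 2 keeps the first shift below \<delta>.\<close>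
  define t where "t k = \<delta> / (real k + 2)" for k
  have t: "0 < t k" "t k < \<delta>" for k using \<delta> by (auto simp: t_def field_simps add_pos_nonneg)
  have t_less: "t k < t j" if "j < k" for j k
    using that \<delta> unfolding t_def by (intro divide_strict_left_mono) (auto intro!: mult_pos_pos)
  define T where "T k = (+) (- (t k *\<^sub>R e)) -` N" for k
  have meas: "T k \<in> sets lborel" for k
    unfolding T_def using N(1) measurable_sets[of "(+) (- (t k *\<^sub>R e))" borel borel N] by simp
  have T_eq: "emeasure lborel (T k) = emeasure lborel N" for k
  proof -
    have "emeasure lborel N = emeasure (distr lborel borel ((+) (- (t k *\<^sub>R e)))) N"
      by (simp add: lborel_distr_plus)
    also have "\<dots> = emeasure lborel (T k)" unfolding T_def using N(1) by (subst emeasure_distr) auto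
    finally show ?thesis ..
  qed
  have disj: "disjoint_family T"
  proof -
    \<comment> \<open>A common point of two translates yields two points of \<open>N\<close> that
      differ by \<open>(t j - t k) *\<^sub>R e\<close>.\<close>
    have "T j \<inter> T k = {}" if "j < k" for j k
    proof (rule ccontr)
      assume "T j \<inter> T k \<noteq> {}"
      then obtain x where x: "- (t j *\<^sub>R e) + x \<in> N" "- (t k *\<^sub>R e) + x \<in> N" unfolding T_def by auto
      have "- (t j *\<^sub>R e) + x + (t j - t k) *\<^sub>R e = - (t k *\<^sub>R e) + x"
        by (simp add: algebra_simps)
      moreover have "- (t j *\<^sub>R e) + x + (t j - t k) *\<^sub>R e \<notin> N"
        using t_less[OF that] t(1)[of k] t(2)[of j] by (intro sep x(1)) auto
      ultimately show False using x(2) by metis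
    qed
    then show ?thesis unfolding disjoint_family_on_def by (metis Int_commute linorder_neqE_nat)
  qed
  obtain R where R: "\<And>x. x \<in> N \<Longrightarrow> norm x \<le> R" using N(2) by (auto simp: bounded_iff)
  have "norm x \<le> R + \<delta> * norm e" if "x \<in> T k" for x k
  proof -
    have "norm (t k *\<^sub>R e) \<le> \<delta> * norm e" using t[of k] by (auto intro!: mult_right_mono)
    moreover have "norm (- (t k *\<^sub>R e) + x) \<le> R" using that R unfolding T_def by auto
    moreover have "norm x \<le> norm (- (t k *\<^sub>R e) + x) + norm (t k *\<^sub>R e)"
      using norm_triangle_ineq[of "- (t k *\<^sub>R e) + x" "t k *\<^sub>R e"] by simp
    ultimately show ?thesis by linarith
  qed
  then have "bounded (\<Union>k. T k)" by (auto simp: bounded_iff)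
  then have fin: "emeasure lborel (\<Union>k. T k) \<noteq> \<infinity>"
    using emeasure_bounded_finite by fastforce
  have "(\<lambda>k. measure lborel (T k)) sums measure lborel (\<Union>k. T k)"
    using meas by (intro measure_UNION disj fin) auto
  then have "summable (\<lambda>k::nat. measure lborel N)"
    unfolding measure_def T_eq by (rule sums_summable)
  then have "measure lborel N = 0" by (simp add: summable_const_iff)
  moreover have "emeasure lborel N \<noteq> \<infinity>" using emeasure_bounded_finite[OF N(2)] by simp
  ultimately have "emeasure lborel N = 0" by (simp add: emeasure_eq_ennreal_measure)
  then show ?thesis using N(1) by auto
qed

text \<open>The slack \<open>r - D e\<close> absorbs the error term of the derivative. Unlike
  \<open>D e < r\<close>, the resulting inequalities for all small \<open>t\<close> are non-strict
  and hence closed conditions for continuous \<open>h\<close>.\<close>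

lemma directional_bound:
  fixes h :: "'e::euclidean_space \<Rightarrow> real"
  assumes "(h has_derivative D) (at p)" "D e < r" "norm e = 1"
  shows "\<exists>\<delta>>0. \<forall>t. 0 < t \<longrightarrow> t < \<delta> \<longrightarrow> h (p + t *\<^sub>R e) - h p \<le> r * t"
proof -
  have "r - D e > 0" using assms by simp
  then obtain d where d: "d > 0" "\<And>y. norm (y - p) < d \<Longrightarrow> norm (h y - h p - D (y - p)) \<le> (r - D e) * norm (y - p)"
    using assms(1) unfolding has_derivative_at_alt by meson
  have lin: "linear D" using assms(1) by (rule has_derivative_linear)
  have "h (p + t *\<^sub>R e) - h p \<le> r * t" if "0 < t" "t < d" for t
    using d(2)[of "p + t *\<^sub>R e"] that assms(3) linear_scale[OF lin, of t e]
    by (simp add: algebra_simps abs_le_iff)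
  then show ?thesis using d(1) by blast
qed

text \<open>
  The set \<open>N\<close> of points where one partner of \<open>q p\<close> has \<open>e\<close>-slope at most \<open>r\<close> to the right and
  another has \<open>e\<close>-slope at least \<open>r'\<close> to the left is disjoint from its small translates: for
  \<open>x = q p\<close> and \<open>x' = q (p + t e)\<close> monotonicity gives
  \<open>c (x', y2') - c (x, y2') \<le> c (x', y1) - c (x, y1)\<close>, that is \<open>r' t \<le> r t\<close>.
\<close>

lemma slope_gap_null:
  fixes q :: "'e::euclidean_space \<Rightarrow> 'a::metric_space" and c :: "'a \<times> 'b::metric_space \<Rightarrow> real"
  assumes c: "continuous_on UNIV c" and q: "open G" "continuous_on G q"
    and K: "compact K1" "compact K2" "cost_monotone c (K1 \<union> K2)" and r: "r < r'" and \<delta>: "\<delta> > 0" and e: "norm e = 1"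
  shows "{p. \<exists>y1 y2. p \<in> cball 0 R \<and> ball p \<delta> \<subseteq> G \<and> (q p, y1) \<in> K1 \<and> (q p, y2) \<in> K2 \<and>
     (\<forall>t. 0 < t \<longrightarrow> t < \<delta> \<longrightarrow> c (q (p + t *\<^sub>R e), y1) - c (q p, y1) \<le> r * t) \<and>
     (\<forall>t. 0 < t \<longrightarrow> t < \<delta> \<longrightarrow> c (q (p + t *\<^sub>R (-e)), y2) - c (q p, y2) \<le> - r' * t)} \<in> null_sets lborel"
    (is "?N \<in> _")
proof -
  \<comment> \<open>Keeping the \<delta>-ball inside the open set \<open>G\<close> leaves a compact
    set of base points whose shifts by less than \<delta> stay in the domain of continuity of
    \<open>q\<close>.\<close>
  define D where "D = cball 0 R \<inter> {p. ball p \<delta> \<subseteq> G}"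
  have "{p. ball p \<delta> \<subseteq> G} = (\<Inter>g\<in>-G. {p. \<delta> \<le> dist p g})" by (auto simp: subset_eq not_less[symmetric])
  also have "closed \<dots>" by (intro closed_INT ballI closed_Collect_le continuous_intros)
  finally have "compact D" unfolding D_def by (intro compact_Int_closed) auto
  define M where "M = D \<times> (snd ` K1 \<times> snd ` K2)"
  have M: "compact M" unfolding M_def using \<open>compact D\<close> K
    by (intro compact_Times compact_continuous_image continuous_intros) auto
  have G: "p \<in> G" "\<And>t. 0 < t \<Longrightarrow> t < \<delta> \<Longrightarrow> p + t *\<^sub>R e \<in> G" "\<And>t. 0 < t \<Longrightarrow> t < \<delta> \<Longrightarrow> p + t *\<^sub>R (-e) \<in> G"
    if "p \<in> D" for p
  proof -
    have "ball p \<delta> \<subseteq> G" using that unfolding D_def by auto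
    moreover have "p \<in> ball p \<delta>" using \<delta> by simp
    moreover have "p + t *\<^sub>R e \<in> ball p \<delta>" "p + t *\<^sub>R (-e) \<in> ball p \<delta>" if "0 < t" "t < \<delta>" for t
      using that e by (auto simp: dist_norm)
    ultimately show "p \<in> G" "\<And>t. 0 < t \<Longrightarrow> t < \<delta> \<Longrightarrow> p + t *\<^sub>R e \<in> G" "\<And>t. 0 < t \<Longrightarrow> t < \<delta> \<Longrightarrow> p + t *\<^sub>R (-e) \<in> G"
      by blast+
  qed
  have cq: "continuous_on M (\<lambda>z. c (q (fst z + v), f z))"
    if "\<And>p. p \<in> D \<Longrightarrow> p + v \<in> G" "continuous_on M f" for v f
    using that by (intro continuous_on_compose2[OF c] continuous_on_compose2[OF q(2)] continuous_intros)
      (auto simp: M_def)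
  have cq0: "continuous_on M (\<lambda>z. q (fst z))"
    using G(1) by (intro continuous_on_compose2[OF q(2)] continuous_intros) (auto simp: M_def)
  have sy: "continuous_on M (\<lambda>z. fst (snd z))" "continuous_on M (\<lambda>z. snd (snd z))"
    by (intro continuous_intros)+
  let ?A1 = "{z \<in> M. (q (fst z), fst (snd z)) \<in> K1}"
  let ?A2 = "{z \<in> M. (q (fst z), snd (snd z)) \<in> K2}"
  \<comment> \<open>The summand 0 makes the base point an instance of \<open>cq\<close> with zero
    shift.\<close>
  let ?B1 = "\<lambda>t. {z \<in> M. c (q (fst z + t *\<^sub>R e), fst (snd z)) - c (q (fst z + 0), fst (snd z)) \<le> r * t}"
  let ?B2 = "\<lambda>t. {z \<in> M. c (q (fst z + t *\<^sub>R (-e)), snd (snd z)) - c (q (fst z + 0), snd (snd z)) \<le> - r' * t}"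
  have clM: "closed M" using M by (rule compact_imp_closed)
  have "closed ?A1" "closed ?A2"
    using continuous_closed_preimage[OF continuous_on_Pair[OF cq0 sy(1)] clM compact_imp_closed[OF K(1)]]
      continuous_closed_preimage[OF continuous_on_Pair[OF cq0 sy(2)] clM compact_imp_closed[OF K(2)]]
    by (simp_all add: vimage_def Int_def)
  moreover have "closed (?B1 t)" "closed (?B2 t)" if t: "0 < t" "t < \<delta>" for t
  proof -
    have "continuous_on M (\<lambda>z. c (q (fst z + t *\<^sub>R e), fst (snd z)) - c (q (fst z + 0), fst (snd z)))"
      "continuous_on M (\<lambda>z. c (q (fst z + t *\<^sub>R (-e)), snd (snd z)) - c (q (fst z + 0), snd (snd z)))"
      using G(1) G(2,3)[OF _ t] sy by (intro continuous_on_diff cq; simp)+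
    from continuous_closed_preimage[OF this(1) clM, of "{..r * t}"] continuous_closed_preimage[OF this(2) clM, of "{..- r' * t}"]
    show "closed (?B1 t)" "closed (?B2 t)" by (auto simp: vimage_def Int_def)
  qed
  ultimately have "closed (?A1 \<inter> ?A2 \<inter> (\<Inter>t\<in>{0<..<\<delta>}. ?B1 t) \<inter> (\<Inter>t\<in>{0<..<\<delta>}. ?B2 t))"
    by (intro closed_Int closed_INT) auto
  then have "compact (M \<inter> (?A1 \<inter> ?A2 \<inter> (\<Inter>t\<in>{0<..<\<delta>}. ?B1 t) \<inter> (\<Inter>t\<in>{0<..<\<delta>}. ?B2 t)))" (is "compact ?Q")
    using M by (rule compact_Int_closed[rotated])
  \<comment> \<open>All conditions are closed on the compact set \<open>M\<close>, so the
    existential quantifiers over \<open>y1\<close> and \<open>y2\<close> amount to projecting a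
    compact set. This makes \<open>?N\<close> measurable.\<close>
  then have "compact (fst ` ?Q)" by (intro compact_continuous_image continuous_intros)
  also have "fst ` ?Q = ?N"
  proof (rule set_eqI, rule iffI)
    fix p assume "p \<in> fst ` ?Q"
    then obtain y1 y2 where y: "(p, y1, y2) \<in> ?Q" by force
    show "p \<in> ?N"
      by (intro CollectI, rule exI[of _ y1], rule exI[of _ y2])
        (use y in \<open>auto simp: M_def D_def\<close>)
  next
    fix p assume "p \<in> ?N"
    then obtain y1 y2 where y: "p \<in> cball 0 R" "ball p \<delta> \<subseteq> G" "(q p, y1) \<in> K1" "(q p, y2) \<in> K2"
      "\<And>t. 0 < t \<Longrightarrow> t < \<delta> \<Longrightarrow> c (q (p + t *\<^sub>R e), y1) - c (q p, y1) \<le> r * t"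
      "\<And>t. 0 < t \<Longrightarrow> t < \<delta> \<Longrightarrow> c (q (p + t *\<^sub>R (-e)), y2) - c (q p, y2) \<le> - r' * t"
      unfolding mem_Collect_eq by blast
    have "(p, y1, y2) \<in> M"
      unfolding M_def D_def using y(1,2) imageI[OF y(3), of snd] imageI[OF y(4), of snd] by simp
    then have "(p, y1, y2) \<in> ?Q" using y(3-6) by (simp del: mult_minus_left scaleR_minus_right)
    then show "p \<in> fst ` ?Q" by (rule rev_image_eqI) simp
  qed
  finally have "compact ?N" .
  show ?thesis
  proof (rule null_if_disjoint_translates[OF _ _ \<delta>, where e=e])
    show "?N \<in> sets borel" "bounded ?N"
      using \<open>compact ?N\<close> by (auto simp: borel_closed compact_imp_closed compact_imp_bounded)
    fix p t assume p: "p \<in> ?N" and t: "0 < t" "t < \<delta>"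
    show "p + t *\<^sub>R e \<notin> ?N"
    proof
      assume p': "p + t *\<^sub>R e \<in> ?N"
      obtain y1 where y1: "(q p, y1) \<in> K1" "c (q (p + t *\<^sub>R e), y1) - c (q p, y1) \<le> r * t"
        using p t by blast
      obtain y2 where y2: "(q (p + t *\<^sub>R e), y2) \<in> K2" "c (q (p + t *\<^sub>R e + t *\<^sub>R (-e)), y2) - c (q (p + t *\<^sub>R e), y2) \<le> - r' * t"
        using p' t by blast
      have "c (q p, y1) + c (q (p + t *\<^sub>R e), y2) \<le> c (q p, y2) + c (q (p + t *\<^sub>R e), y1)"
        using cost_monotoneD[OF K(3)] y1 y2 by blast
      moreover have "c (q p, y2) - c (q (p + t *\<^sub>R e), y2) \<le> - r' * t" using y2(2) by simp
      ultimately have "r' * t \<le> r * t" using y1(2) by linarith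
      then show False using r t by simp
    qed
  qed
qed

text \<open>Two different linear maps differ on a basis vector, and two rationals fit between the
  values. Fixing these data, a pair of compact pieces of \<open>S\<close> and a scale
  \<open>n\<close> leaves countably many instances of \<open>slope_gap_null\<close>.\<close>

lemma distinct_slopes_null:
  fixes q :: "'e::euclidean_space \<Rightarrow> 'a::metric_space" and c :: "'a \<times> 'b::metric_space \<Rightarrow> real"
  assumes c: "continuous_on UNIV c" and q: "open G" "continuous_on G q"
    and S: "sigma_compact S" "cost_monotone c S"
  shows "\<exists>Z\<in>null_sets lborel. \<forall>p\<in>G. \<forall>y1 y2 D1 D2. (q p, y1) \<in> S \<longrightarrow> (q p, y2) \<in> S \<longrightarrow>
     ((\<lambda>p. c (q p, y1)) has_derivative D1) (at p) \<longrightarrow> ((\<lambda>p. c (q p, y2)) has_derivative D2) (at p) \<longrightarrow>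
     D1 \<noteq> D2 \<longrightarrow> p \<in> Z"
proof -
  obtain \<K> where K: "countable \<K>" "\<And>K. K \<in> \<K> \<Longrightarrow> compact K" "S = \<Union>\<K>"
    using S(1) unfolding sigma_compact_def by blast
  define N where "N K1 K2 n r r' e = {p. \<exists>y1 y2. p \<in> cball 0 (real n) \<and> ball p (1 / Suc n) \<subseteq> G \<and> (q p, y1) \<in> K1 \<and> (q p, y2) \<in> K2 \<and>
     (\<forall>t. 0 < t \<longrightarrow> t < 1 / Suc n \<longrightarrow> c (q (p + t *\<^sub>R e), y1) - c (q p, y1) \<le> r * t) \<and>
     (\<forall>t. 0 < t \<longrightarrow> t < 1 / Suc n \<longrightarrow> c (q (p + t *\<^sub>R (-e)), y2) - c (q p, y2) \<le> - r' * t)}"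
    for K1 K2 n r r' e
  define Z where "Z = (\<Union>K1\<in>\<K>. \<Union>K2\<in>\<K>. \<Union>n. \<Union>r\<in>\<rat>. \<Union>r'\<in>\<rat>\<inter>{r<..}. \<Union>e\<in>Basis. N K1 K2 n r r' e)"
  have null: "N K1 K2 n r r' e \<in> null_sets lborel" if "K1 \<in> \<K>" "K2 \<in> \<K>" "r < r'" "e \<in> Basis" for K1 K2 n r r' e
    unfolding N_def using that K by (intro slope_gap_null c q cost_monotone_subset[OF S(2)]) auto
  have Z: "Z \<in> null_sets lborel"
    unfolding Z_def using K(1) null
    by (intro null_sets_UN' null countable_Int1 countable_rat countableI_type countable_finite[OF finite_Basis]) auto
  have *: "p \<in> Z" if p: "p \<in> G" and y: "(q p, y1) \<in> S" "(q p, y2) \<in> S"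
    and D: "((\<lambda>p. c (q p, y1)) has_derivative D1) (at p)" "((\<lambda>p. c (q p, y2)) has_derivative D2) (at p)"
    and e: "e \<in> Basis" "D1 e < D2 e" for p y1 y2 D1 D2 e
  proof -
    obtain r where r: "r \<in> \<rat>" "D1 e < r" "r < D2 e" using Rats_dense_in_real[OF e(2)] by blast
    obtain r' where r': "r' \<in> \<rat>" "r < r'" "r' < D2 e" using Rats_dense_in_real[OF r(3)] by blast
    obtain \<delta>1 where \<delta>1: "\<delta>1 > 0" "\<And>t. 0 < t \<Longrightarrow> t < \<delta>1 \<Longrightarrow> c (q (p + t *\<^sub>R e), y1) - c (q p, y1) \<le> r * t"
      using directional_bound[OF D(1) r(2)] e(1) by auto
    \<comment> \<open>The slope to the left is a slope to the right in direction \<open>-e\<close>,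
      so one one-sided bound serves both partners.\<close>
    have "D2 (- e) < - r'" using r'(3) linear_neg[OF has_derivative_linear[OF D(2)]] by simp
    from directional_bound[OF D(2) this]
    obtain \<delta>2 where \<delta>2: "\<delta>2 > 0" "\<And>t. 0 < t \<Longrightarrow> t < \<delta>2 \<Longrightarrow> c (q (p + t *\<^sub>R (-e)), y2) - c (q p, y2) \<le> - r' * t"
      using e(1) by auto
    obtain \<delta>3 where \<delta>3: "\<delta>3 > 0" "ball p \<delta>3 \<subseteq> G" using q(1) p by (meson openE)
    define \<delta> where "\<delta> = min \<delta>1 (min \<delta>2 \<delta>3)"
    have "\<delta> > 0" using \<delta>1 \<delta>2 \<delta>3 by (simp add: \<delta>_def)
    obtain n1 where n1: "1 / Suc n1 < \<delta>" using reals_Archimedean[OF \<open>\<delta> > 0\<close>] by (auto simp: inverse_eq_divide)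
    obtain n2 where n2: "norm p \<le> real n2" using real_arch_simple by blast
    \<comment> \<open>The single index \<open>n\<close> bounds both the norm of \<open>p\<close> and
      the inverse of the radius, so the larger demand is taken.\<close>
    define n where "n = max n1 n2"
    have "1 / real (Suc n) \<le> 1 / Suc n1" unfolding n_def by (intro divide_left_mono) auto
    then have n: "1 / Suc n < \<delta>" "norm p \<le> real n" using n1 n2 by (auto simp: n_def)
    obtain K1 K2 where "K1 \<in> \<K>" "K2 \<in> \<K>" "(q p, y1) \<in> K1" "(q p, y2) \<in> K2" using y K(3) by auto
    moreover have "p \<in> N K1 K2 n r r' e" unfolding N_def
    proof (rule CollectI, rule exI[of _ y1], rule exI[of _ y2], intro conjI allI impI)
      show "p \<in> cball 0 (real n)" using n by simp
      show "ball p (1 / Suc n) \<subseteq> G" using \<delta>3(2) n(1) by (auto simp: \<delta>_def subset_eq)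
      show "c (q (p + t *\<^sub>R e), y1) - c (q p, y1) \<le> r * t" if "0 < t" "t < 1 / Suc n" for t
        using that n(1) by (intro \<delta>1) (auto simp: \<delta>_def)
      show "c (q (p + t *\<^sub>R (-e)), y2) - c (q p, y2) \<le> - r' * t" if "0 < t" "t < 1 / Suc n" for t
        using that n(1) by (intro \<delta>2) (auto simp: \<delta>_def)
    qed fact+
    ultimately show "p \<in> Z" unfolding Z_def using r r' e by blast
  qed
  show ?thesis
  proof (rule bexI[OF _ Z], intro ballI allI impI)
    fix p y1 y2 D1 D2
    assume p: "p \<in> G" and y: "(q p, y1) \<in> S" "(q p, y2) \<in> S"
      and D: "((\<lambda>p. c (q p, y1)) has_derivative D1) (at p)" "((\<lambda>p. c (q p, y2)) has_derivative D2) (at p)"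
      and neq: "D1 \<noteq> D2"
    have "\<exists>e\<in>Basis. D1 e \<noteq> D2 e"
      using neq linear_eq_stdbasis[OF has_derivative_linear[OF D(1)] has_derivative_linear[OF D(2)]] by blast
    then obtain e where e: "e \<in> Basis" "D1 e < D2 e \<or> D2 e < D1 e" by force
    \<comment> \<open>In the second case the two partners exchange their roles.\<close>
    then show "p \<in> Z" using *[OF p y D e(1)] *[OF p y(2,1) D(2,1) e(1)] by blast
  qed
qed

section \<open>Optimal couplings are carried by monotone sets\<close>

lemma couplings_integrable:
  fixes c :: "'a::polish_space \<times> 'b::polish_space \<Rightarrow> real"
  assumes "\<gamma> \<in> couplings \<mu> \<nu>" "prob_space \<mu>" "continuous_on UNIV c" "bounded (range c)"
  shows "integrable \<gamma> c"
proof -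
  interpret prob_space \<gamma> by (rule couplings_prob_space[OF assms(1,2)])
  obtain B where B: "\<And>z. norm (c z) \<le> B" using assms(4) by (auto simp: bounded_iff)
  have "c \<in> borel_measurable \<gamma>"
    unfolding measurable_cong_sets[OF couplings_space(1)[OF assms(1)] refl]
    by (rule borel_measurable_continuous_onI[OF assms(3)])
  then show ?thesis using B by (intro integrable_const_bound[of _ B]) auto
qed

text \<open>
  Draw two independent points \<open>(x, y)\<close>, \<open>(x', y')\<close> from \<open>\<gamma>\<close> and replace the first one by
  \<open>(x, y')\<close> whenever exchanging partners lowers the total cost. The event is symmetric, so this
  is again a coupling, and symmetrisation shows that its cost is smaller unless the event is null.
\<close>

lemma optimal_swap_null:
  fixes \<gamma> :: "('a::polish_space \<times> 'b::polish_space) measure" and c :: "'a \<times> 'b \<Rightarrow> real"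
  assumes \<gamma>: "\<gamma> \<in> couplings \<mu> \<nu>" and \<mu>: "prob_space \<mu>"
    and c: "continuous_on UNIV c" "bounded (range c)"
    and opt: "\<And>\<delta>. \<delta> \<in> couplings \<mu> \<nu> \<Longrightarrow> (LINT p|\<gamma>. c p) \<le> (LINT p|\<delta>. c p)"
  defines "G \<equiv> {((x, y), (x', y')). c (x, y') + c (x', y) < c (x, y) + c (x', y')}"
  shows "emeasure (\<gamma> \<Otimes>\<^sub>M \<gamma>) G = 0"
proof -
  note s = couplings_space[OF \<gamma>]
  interpret \<gamma>: prob_space \<gamma> by (rule couplings_prob_space[OF \<gamma> \<mu>])
  interpret P: pair_prob_space \<gamma> \<gamma> ..
  let ?P = "\<gamma> \<Otimes>\<^sub>M \<gamma>"
  have "(borel :: ('a \<times> 'b) measure) \<Otimes>\<^sub>M (borel :: ('a \<times> 'b) measure) = borel" by (rule borel_prod)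
  then have setsP: "sets ?P = sets borel"
    using sets_pair_measure_cong[OF s(1) s(1)] by metis
  have spaceP: "space ?P = UNIV" using sets_eq_imp_space_eq[OF setsP] by simp
  have meas_cont: "f \<in> measurable ?P borel" if "continuous_on UNIV f" for f :: "_ \<Rightarrow> 'z::topological_space"
    unfolding measurable_cong_sets[OF setsP refl] by (rule borel_measurable_continuous_onI[OF that])
  define g where "g z = c (fst (fst z), snd (snd z)) + c (fst (snd z), snd (fst z)) - c (fst z) - c (snd z)" for z
  have cc: "continuous_on UNIV (\<lambda>z. c (f z))" if "continuous_on UNIV f" for f :: "('a \<times> 'b) \<times> ('a \<times> 'b) \<Rightarrow> _"
    by (rule continuous_on_compose2[OF c(1) that]) simp
  have cont_cross: "continuous_on UNIV (\<lambda>z::('a \<times> 'b) \<times> ('a \<times> 'b). c (fst (fst z), snd (snd z)))"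
    "continuous_on UNIV (\<lambda>z::('a \<times> 'b) \<times> ('a \<times> 'b). c (fst (snd z), snd (fst z)))"
    "continuous_on UNIV (\<lambda>z::('a \<times> 'b) \<times> ('a \<times> 'b). c (fst z))"
    "continuous_on UNIV (\<lambda>z::('a \<times> 'b) \<times> ('a \<times> 'b). c (snd z))"
    by (intro cc continuous_intros)+
  have g_cont: "continuous_on UNIV g" unfolding g_def by (intro continuous_intros cont_cross)
  have G_eq: "G = {z. g z < 0}" unfolding G_def g_def by auto
  have "open G" unfolding G_eq using g_cont by (intro open_Collect_less continuous_intros)
  then have Gm: "G \<in> sets ?P" unfolding setsP by simp
  let ?sw = "\<lambda>z::('a \<times> 'b) \<times> ('a \<times> 'b). (snd z, fst z)"
  have sw_m: "?sw \<in> measurable ?P ?P" by measurable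
  have sw: "distr ?P ?P ?sw = ?P" using P.distr_pair_swap by (simp add: case_prod_beta')
  have G_sw: "?sw z \<in> G \<longleftrightarrow> z \<in> G" for z unfolding G_eq g_def by (auto simp: algebra_simps)
  define T where "T z = (if z \<in> G then (fst (fst z), snd (snd z)) else fst z)" for z
  have T_m: "T \<in> measurable ?P borel" unfolding T_def using Gm
    by (intro measurable_If_set meas_cont continuous_intros) auto
  define \<delta> where "\<delta> = distr ?P borel T"
  have \<delta>: "\<delta> \<in> couplings \<mu> \<nu>"
  proof -
    have "distr ?P borel fst = distr ?P \<gamma> fst" by (rule distr_cong) (simp_all add: s)
    then have P1: "distr ?P borel fst = \<gamma>" by (simp add: \<gamma>.distr_pair_fst)
    have fst_b: "(fst :: 'a \<times> 'b \<Rightarrow> 'a) \<in> measurable borel borel" "(snd :: 'a \<times> 'b \<Rightarrow> 'b) \<in> measurable borel borel"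
      by (auto intro!: borel_measurable_continuous_onI continuous_on_fst continuous_on_snd continuous_on_id)
    have "distr \<delta> borel fst = distr ?P borel (\<lambda>z. fst (fst z))"
      unfolding \<delta>_def by (subst distr_distr[OF fst_b(1) T_m]) (auto intro!: distr_cong simp: T_def)
    also have "\<dots> = distr (distr ?P borel fst) borel fst"
      by (subst distr_distr[OF fst_b(1) meas_cont]) (auto intro!: distr_cong continuous_intros)
    finally have 1: "distr \<delta> borel fst = \<mu>" unfolding P1 s .
    have m1: "(\<lambda>z. snd (fst z)) \<in> measurable ?P borel" and m2: "(\<lambda>z. snd (snd z)) \<in> measurable ?P borel"
      by (intro meas_cont continuous_intros)+
    have "distr \<delta> borel snd = distr ?P borel (\<lambda>z. snd (T z))"
      unfolding \<delta>_def by (subst distr_distr[OF fst_b(2) T_m]) (auto intro!: distr_cong)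
    also have "\<dots> = distr ?P borel (\<lambda>z. snd (fst z))"
    proof (rule measure_eqI)
      fix A assume "A \<in> sets (distr ?P borel (\<lambda>z. snd (T z)))"
      then have A: "A \<in> sets borel" by simp
      have Tm: "(\<lambda>z. snd (T z)) \<in> measurable ?P borel" by (rule measurable_compose[OF T_m fst_b(2)])
      have A1: "(\<lambda>z. snd (fst z)) -` A \<in> sets ?P" and A2: "(\<lambda>z. snd (snd z)) -` A \<in> sets ?P"
        using measurable_sets[OF m1 A] measurable_sets[OF m2 A] by (auto simp: spaceP)
      \<comment> \<open>Interchanging the draws preserves the product measure and \<open>G\<close>.
        So, on \<open>G\<close>, the second coordinates of the two draws have the same law, and
        \<open>T\<close> does not disturb the second marginal.\<close>
      have swap: "emeasure ?P (G \<inter> (\<lambda>z. snd (snd z)) -` A) = emeasure ?P (G \<inter> (\<lambda>z. snd (fst z)) -` A)"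
      proof -
        have "emeasure ?P (G \<inter> (\<lambda>z. snd (snd z)) -` A) = emeasure (distr ?P ?P ?sw) (G \<inter> (\<lambda>z. snd (snd z)) -` A)"
          by (simp add: sw)
        also have "\<dots> = emeasure ?P (?sw -` (G \<inter> (\<lambda>z. snd (snd z)) -` A) \<inter> space ?P)"
          using Gm A2 by (intro emeasure_distr sw_m) auto
        also have "?sw -` (G \<inter> (\<lambda>z. snd (snd z)) -` A) \<inter> space ?P = G \<inter> (\<lambda>z. snd (fst z)) -` A"
          using G_sw by (auto simp: spaceP)
        finally show ?thesis .
      qed
      have "emeasure (distr ?P borel (\<lambda>z. snd (T z))) A = emeasure ?P ((\<lambda>z. snd (T z)) -` A)"
        by (subst emeasure_distr[OF Tm A]) (simp add: spaceP)
      also have "(\<lambda>z. snd (T z)) -` A = (G \<inter> (\<lambda>z. snd (snd z)) -` A) \<union> ((\<lambda>z. snd (fst z)) -` A - G)"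
        by (rule set_eqI) (simp add: T_def)
      also have "emeasure ?P ((G \<inter> (\<lambda>z. snd (snd z)) -` A) \<union> ((\<lambda>z. snd (fst z)) -` A - G)) = emeasure ?P (G \<inter> (\<lambda>z. snd (snd z)) -` A) + emeasure ?P ((\<lambda>z. snd (fst z)) -` A - G)"
        using Gm A1 A2 by (intro plus_emeasure[symmetric]) auto
      also have "\<dots> = emeasure ?P (G \<inter> (\<lambda>z. snd (fst z)) -` A) + emeasure ?P ((\<lambda>z. snd (fst z)) -` A - G)"
        by (simp add: swap)
      also have "\<dots> = emeasure ?P ((\<lambda>z. snd (fst z)) -` A)"
        using Gm A1 by (subst plus_emeasure) (auto intro!: arg_cong[where f="emeasure ?P"])
      also have "\<dots> = emeasure (distr ?P borel (\<lambda>z. snd (fst z))) A"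
        by (subst emeasure_distr[OF m1 A]) (simp add: spaceP)
      finally show "emeasure (distr ?P borel (\<lambda>z. snd (T z))) A = emeasure (distr ?P borel (\<lambda>z. snd (fst z))) A" .
    qed simp
    also have "\<dots> = distr (distr ?P borel fst) borel snd"
      by (subst distr_distr[OF fst_b(2) meas_cont]) (auto intro!: distr_cong continuous_intros)
    finally have 2: "distr \<delta> borel snd = \<nu>" unfolding P1 s .
    show ?thesis unfolding couplings_def using 1 2 by (simp add: \<delta>_def)
  qed
  obtain B where B: "\<And>z. \<bar>c z\<bar> \<le> B" using c(2) by (auto simp: bounded_iff)
  have int: "integrable ?P f" if "continuous_on UNIV f" "\<And>z. \<bar>f z\<bar> \<le> b" for f :: "_ \<Rightarrow> real" and b
    using that meas_cont[OF that(1)] by (intro P.integrable_const_bound[of _ b]) auto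
  have int_c: "integrable ?P (\<lambda>z. c (fst z))" "integrable ?P (\<lambda>z. c (snd z))"
     "integrable ?P (\<lambda>z. c (fst (fst z), snd (snd z)))" "integrable ?P (\<lambda>z. c (fst (snd z), snd (fst z)))"
    using cont_cross B by (auto intro!: int[of _ B])
  \<comment> \<open>\<open>?h\<close> and \<open>?h'\<close> are the changes of cost for the first
    and the second draw. Neither has a sign on \<open>G\<close>, but their sum is
    \<open>indicator G z * g z\<close>, and interchanging the draws shows that their integrals
    agree.\<close>
  let ?h = "\<lambda>z. indicator G z * (c (fst (fst z), snd (snd z)) - c (fst z))"
  let ?h' = "\<lambda>z. indicator G z * (c (fst (snd z), snd (fst z)) - c (snd z))"
  have int_h: "integrable ?P ?h" "integrable ?P ?h'"
    using integrable_mult_indicator[OF Gm Bochner_Integration.integrable_diff[OF int_c(3,1)]]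
      integrable_mult_indicator[OF Gm Bochner_Integration.integrable_diff[OF int_c(4,2)]]
    by (simp_all only: real_scaleR_def)
  have h_eq: "(LINT z|?P. ?h z) = (LINT z|?P. ?h' z)"
  proof -
    have "(LINT z|?P. ?h z) = (LINT z|distr ?P ?P ?sw. ?h z)" by (simp add: sw)
    also have "\<dots> = (LINT z|?P. ?h (?sw z))"
      using int_h(1) by (intro integral_distr sw_m) auto
    also have "(\<lambda>z. ?h (?sw z)) = ?h'" using G_sw by (auto simp: fun_eq_iff indicator_def)
    finally show ?thesis .
  qed
  have "(LINT p|\<gamma>. c p) = (LINT p|distr ?P \<gamma> fst. c p)" by (simp add: \<gamma>.distr_pair_fst)
  also have "\<dots> = (LINT z|?P. c (fst z))"
    using couplings_integrable[OF \<gamma> \<mu> c] by (intro integral_distr) auto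
  finally have c1: "(LINT p|\<gamma>. c p) = (LINT z|?P. c (fst z))" .
  have "(LINT p|\<delta>. c p) = (LINT z|?P. c (T z))"
    unfolding \<delta>_def by (intro integral_distr T_m borel_measurable_continuous_onI c)
  also have "(\<lambda>z. c (T z)) = (\<lambda>z. c (fst z) + ?h z)" by (auto simp: T_def fun_eq_iff indicator_def)
  also have "(LINT z|?P. c (fst z) + ?h z) = (LINT z|?P. c (fst z)) + (LINT z|?P. ?h z)"
    using int_c int_h by (intro Bochner_Integration.integral_add) auto
  finally have "(LINT z|?P. ?h z) \<ge> 0" using opt[OF \<delta>] c1 by simp
  moreover have "(LINT z|?P. ?h z + ?h' z) = (LINT z|?P. ?h z) + (LINT z|?P. ?h' z)"
    using int_h by (intro Bochner_Integration.integral_add)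
  ultimately have ge: "(LINT z|?P. ?h z + ?h' z) \<ge> 0" using h_eq by simp
  have hg: "?h z + ?h' z = indicator G z * g z" for z unfolding g_def by (simp add: algebra_simps)
  have "integrable ?P (\<lambda>z. ?h z + ?h' z)" using int_h by (rule Bochner_Integration.integrable_add)
  then have int_n: "integrable ?P (\<lambda>z. - (indicator G z * g z))" unfolding hg by simp
  have nonneg: "0 \<le> - (indicator G z * g z)" for z unfolding G_eq by (auto simp: indicator_def)
  have "(LINT z|?P. - (indicator G z * g z)) \<le> 0" using ge unfolding hg by simp
  moreover have "(LINT z|?P. - (indicator G z * g z)) \<ge> 0" using nonneg by (intro Bochner_Integration.integral_nonneg)
  ultimately have "(LINT z|?P. - (indicator G z * g z)) = 0" by simp
  then have "AE z in ?P. - (indicator G z * g z) = 0"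
    using integral_nonneg_eq_0_iff_AE[OF int_n] nonneg by auto
  then have "AE z in ?P. z \<notin> G" by eventually_elim (auto simp: indicator_def G_eq)
  then show ?thesis using AE_iff_null_sets[OF Gm] by auto
qed

text \<open>The carrier is the support: the complement of all null basic open sets, whose union is
  null by countability of the basis. A violating pair in the support would have a product
  neighbourhood of positive mass inside the open set of violations.\<close>

lemma optimal_cost_monotone:
  fixes \<gamma> :: "('a::polish_space \<times> 'b::polish_space) measure" and c :: "'a \<times> 'b \<Rightarrow> real"
  assumes \<gamma>: "\<gamma> \<in> couplings \<mu> \<nu>" and \<mu>: "prob_space \<mu>"
    and c: "continuous_on UNIV c" "bounded (range c)"
    and opt: "\<And>\<delta>. \<delta> \<in> couplings \<mu> \<nu> \<Longrightarrow> (LINT p|\<gamma>. c p) \<le> (LINT p|\<delta>. c p)"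
  obtains S where "closed S" "cost_monotone c S" "emeasure \<gamma> (- S) = 0"
proof -
  note s = couplings_space[OF \<gamma>]
  interpret \<gamma>: prob_space \<gamma> by (rule couplings_prob_space[OF \<gamma> \<mu>])
  interpret P: pair_prob_space \<gamma> \<gamma> ..
  obtain \<B> :: "('a \<times> 'b) set set" where \<B>: "countable \<B>" "topological_basis \<B>"
    using ex_countable_basis by blast
  define N where "N = \<Union>{U \<in> \<B>. emeasure \<gamma> U = 0}"
  have "(\<Union>U\<in>{U \<in> \<B>. emeasure \<gamma> U = 0}. U) \<in> null_sets \<gamma>"
    using \<B> topological_basis_open[OF \<B>(2)]
    by (intro null_sets_UN') (auto simp: null_sets_def s intro: countable_subset[OF _ \<B>(1)])
  then have "N \<in> null_sets \<gamma>" unfolding N_def by simp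
  moreover have "open N" unfolding N_def using topological_basis_open[OF \<B>(2)] by auto
  moreover have "cost_monotone c (- N)" unfolding cost_monotone_def
  proof (intro allI impI, rule ccontr)
    fix x y x' y' assume z: "(x, y) \<in> - N" "(x', y') \<in> - N" and "\<not> c (x, y) + c (x', y') \<le> c (x, y') + c (x', y)"
    let ?G = "{((x, y), (x', y')). c (x, y') + c (x', y) < c (x, y) + c (x', y')}"
    have cc: "continuous_on UNIV (\<lambda>z. c (f z))" if "continuous_on UNIV f" for f :: "('a \<times> 'b) \<times> ('a \<times> 'b) \<Rightarrow> _"
      by (rule continuous_on_compose2[OF c(1) that]) simp
    have G_eq: "?G = {z. c (fst (fst z), snd (snd z)) + c (fst (snd z), snd (fst z)) < c (fst z) + c (snd z)}" by auto
    have "open ?G" unfolding G_eq by (intro open_Collect_less continuous_on_add cc continuous_intros)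
    moreover have "((x, y), (x', y')) \<in> ?G" using \<open>\<not> _\<close> by auto
    ultimately obtain U V where UV: "open U" "open V" "(x, y) \<in> U" "(x', y') \<in> V" "U \<times> V \<subseteq> ?G"
      by (rule open_prod_elim) auto
    obtain U' where U': "U' \<in> \<B>" "(x, y) \<in> U'" "U' \<subseteq> U" using topological_basisE[OF \<B>(2) UV(1,3)] .
    obtain V' where V': "V' \<in> \<B>" "(x', y') \<in> V'" "V' \<subseteq> V" using topological_basisE[OF \<B>(2) UV(2,4)] .
    have "emeasure \<gamma> U' \<noteq> 0" "emeasure \<gamma> V' \<noteq> 0" using z U' V' unfolding N_def by auto
    moreover have "U' \<in> sets \<gamma>" "V' \<in> sets \<gamma>" using U' V' topological_basis_open[OF \<B>(2)] by (auto simp: s)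
    ultimately have "emeasure (\<gamma> \<Otimes>\<^sub>M \<gamma>) (U' \<times> V') \<noteq> 0" by (simp add: \<gamma>.emeasure_pair_measure_Times)
    moreover have "(borel :: ('a \<times> 'b) measure) \<Otimes>\<^sub>M (borel :: ('a \<times> 'b) measure) = borel" by (rule borel_prod)
    then have "sets (\<gamma> \<Otimes>\<^sub>M \<gamma>) = sets borel"
      using sets_pair_measure_cong[OF s(1) s(1)] by metis
    then have "?G \<in> sets (\<gamma> \<Otimes>\<^sub>M \<gamma>)" using borel_open[OF \<open>open ?G\<close>] by (simp only:)
    then have "emeasure (\<gamma> \<Otimes>\<^sub>M \<gamma>) (U' \<times> V') \<le> emeasure (\<gamma> \<Otimes>\<^sub>M \<gamma>) ?G"
      using U' V' UV(5) by (intro emeasure_mono) auto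
    ultimately show False using optimal_swap_null[OF \<gamma> \<mu> c opt] by simp
  qed
  ultimately show ?thesis by (intro that[of "- N"]) auto
qed

text \<open>The average is the mixture by a fair coin, so its values and its integral come from
  those of a bind. The statement on null sets transfers a carrier of the average to both
  couplings.\<close>

lemma ex_average_coupling:
  fixes \<gamma> :: "('a::polish_space \<times> 'b::polish_space) measure" and c :: "'a \<times> 'b \<Rightarrow> real"
  assumes \<gamma>: "\<gamma> \<in> couplings \<mu> \<nu>" "\<gamma>' \<in> couplings \<mu> \<nu>" and \<mu>: "prob_space \<mu>"
    and c: "continuous_on UNIV c" "bounded (range c)"
  obtains \<delta> where "\<delta> \<in> couplings \<mu> \<nu>" "2 * (LINT p|\<delta>. c p) = (LINT p|\<gamma>. c p) + (LINT p|\<gamma>'. c p)"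
    "\<And>A. A \<in> sets borel \<Longrightarrow> emeasure \<delta> A = 0 \<Longrightarrow> emeasure \<gamma> A = 0 \<and> emeasure \<gamma>' A = 0"
proof -
  note s = couplings_space[OF \<gamma>(1)] couplings_space[OF \<gamma>(2)]
  interpret \<gamma>: prob_space \<gamma> by (rule couplings_prob_space[OF \<gamma>(1) \<mu>])
  interpret \<gamma>': prob_space \<gamma>' by (rule couplings_prob_space[OF \<gamma>(2) \<mu>])
  let ?b = "measure_pmf (bernoulli_pmf (1/2))"
  let ?k = "\<lambda>b. if b then \<gamma> else \<gamma>'"
  define \<delta> where "\<delta> = ?b \<bind> ?k"
  have k: "?k \<in> measurable ?b (subprob_algebra borel)"
    using s by (auto simp: space_subprob_algebra \<gamma>.subprob_space_axioms \<gamma>'.subprob_space_axioms)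
  have sets: "sets \<delta> = sets borel" unfolding \<delta>_def by (rule sets_bind) (auto simp: s)
  have em: "emeasure \<delta> A = ennreal (1/2) * emeasure \<gamma> A + ennreal (1/2) * emeasure \<gamma>' A" if "A \<in> sets borel" for A
    unfolding \<delta>_def using that by (subst emeasure_bind[OF _ k]) (auto simp: nn_integral_bernoulli_pmf mult.commute)
  have half: "inverse 2 * a + inverse 2 * a = a" for a :: ennreal
  proof -
    have "ennreal (1/2) + ennreal (1/2) = 1" by (subst ennreal_plus[symmetric]) auto
    then have "inverse 2 + inverse 2 = (1 :: ennreal)" by simp
    then show ?thesis unfolding distrib_right[symmetric] by simp
  qed
  have fs: "fst \<in> measurable borel (borel :: 'a measure)" "snd \<in> measurable borel (borel :: 'b measure)"
    by (auto intro!: borel_measurable_continuous_onI continuous_on_fst continuous_on_snd continuous_on_id)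
  have fsd: "fst \<in> measurable \<delta> borel" "snd \<in> measurable \<delta> borel" 
    using fs unfolding measurable_cong_sets[OF sets refl] by auto
  have spd: "space \<delta> = UNIV" using sets_eq_imp_space_eq[OF sets] by simp
  have vim: "fst -` A = A \<times> (UNIV :: 'b set)" "snd -` C = (UNIV :: 'a set) \<times> C" for A :: "'a set" and C :: "'b set" by auto
  have setsm: "sets \<mu> = sets borel" "sets \<nu> = sets borel" using s by (metis sets_distr)+
  have "distr \<delta> borel fst = \<mu>"
  proof (rule measure_eqI)
    fix A assume "A \<in> sets (distr \<delta> borel fst)"
    then have A: "A \<in> sets borel" by simp
    then have "A \<times> UNIV \<in> sets (borel :: ('a \<times> 'b) measure)" by (auto intro: borel_Times)
    with A show "emeasure (distr \<delta> borel fst) A = emeasure \<mu> A"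
      by (simp add: emeasure_distr[OF fsd(1)] spd vim em couplings_emeasure(1)[OF \<gamma>(1)] couplings_emeasure(1)[OF \<gamma>(2)] half)
  qed (simp add: setsm)
  moreover have "distr \<delta> borel snd = \<nu>"
  proof (rule measure_eqI)
    fix A assume "A \<in> sets (distr \<delta> borel snd)"
    then have A: "A \<in> sets borel" by simp
    then have "UNIV \<times> A \<in> sets (borel :: ('a \<times> 'b) measure)" by (auto intro: borel_Times)
    with A show "emeasure (distr \<delta> borel snd) A = emeasure \<nu> A"
      by (simp add: emeasure_distr[OF fsd(2)] spd vim em couplings_emeasure(2)[OF \<gamma>(1)] couplings_emeasure(2)[OF \<gamma>(2)] half)
  qed (simp add: setsm)
  ultimately have 1: "\<delta> \<in> couplings \<mu> \<nu>" unfolding couplings_def using sets by simp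
  obtain B where B: "\<And>z. \<bar>c z\<bar> \<le> B" using c(2) by (auto simp: bounded_iff)
  have "(LINT p|\<delta>. c p) = (LINT b|?b. LINT p|?k b. c p)"
    unfolding \<delta>_def
  proof (rule integral_bind[OF _ _ k])
    have "emeasure (?k b) (space (?k b)) \<le> ennreal 1" for b
      by (simp add: \<gamma>.emeasure_space_1 \<gamma>'.emeasure_space_1)
    then show "AE b in ?b. emeasure (?k b) (space (?k b)) \<le> ennreal 1" by blast
    show "c \<in> borel_measurable borel" by (rule borel_measurable_continuous_onI[OF c(1)])
    show "finite_measure ?b" by (rule measure_pmf.finite_measure_axioms)
  qed (use B in auto)
  also have "\<dots> = (LINT p|\<gamma>. c p) / 2 + (LINT p|\<gamma>'. c p) / 2"
    by (simp add: integral_bernoulli_pmf)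
  finally have 2: "2 * (LINT p|\<delta>. c p) = (LINT p|\<gamma>. c p) + (LINT p|\<gamma>'. c p)" by simp
  have 3: "emeasure \<gamma> A = 0 \<and> emeasure \<gamma>' A = 0" if "A \<in> sets borel" "emeasure \<delta> A = 0" for A
    using that by (simp add: em)
  show ?thesis by (rule that[OF 1 2 3])
qed

section \<open>Existence of optimal couplings\<close>

text \<open>Tychonoff for \<open>[0,1]\<close> to the power of all sets. With uncountably many
  coordinates a convergent subsequence need not exist; a cluster point still approximates finitely
  many coordinates at arbitrarily late indices.\<close>

lemma ex_cluster_function:
  fixes m :: "nat \<Rightarrow> 's \<Rightarrow> real"
  assumes "\<And>n D. m n D \<in> {0..1}"
  obtains \<beta> where "\<And>J e N. finite J \<Longrightarrow> e > 0 \<Longrightarrow> \<exists>n\<ge>N. \<forall>D\<in>J. \<bar>m n D - \<beta> D\<bar> < e"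
proof -
  let ?U = "PiE UNIV (\<lambda>_::'s. {0..1::real})"
  have "compactin (product_topology (\<lambda>_. euclidean) UNIV) ?U"
    by (subst compactin_PiE) simp
  then have "compact ?U" by (simp add: euclidean_product_topology)
  moreover have "filtermap m sequentially \<noteq> bot" by (simp add: filtermap_bot_iff)
  moreover have "eventually (\<lambda>x. x \<in> ?U) (filtermap m sequentially)"
    using assms by (simp add: eventually_filtermap PiE_iff)
  ultimately obtain \<beta> where \<beta>: "inf (nhds \<beta>) (filtermap m sequentially) \<noteq> bot"
    unfolding compact_filter by blast
  show ?thesis
  proof (rule that)
    fix J :: "'s set" and e :: real and N :: nat
    assume J: "finite J" and e: "e > 0"
    let ?V = "\<Inter>D\<in>J. {f. \<bar>f D - \<beta> D\<bar> < e}"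
    have "open ?V" using J
      by (intro open_INT ballI open_Collect_less continuous_intros continuous_on_product_coordinates) auto
    then have "eventually (\<lambda>f. f \<in> ?V) (nhds \<beta>)" using e by (intro eventually_nhds_in_open) auto
    moreover have "eventually (\<lambda>f. \<exists>n\<ge>N. f = m n) (filtermap m sequentially)"
      unfolding eventually_filtermap by (intro eventually_sequentiallyI[of N]) auto
    ultimately have "eventually (\<lambda>f. f \<in> ?V \<and> (\<exists>n\<ge>N. f = m n)) (inf (nhds \<beta>) (filtermap m sequentially))"
      unfolding eventually_inf by blast
    then obtain f where "f \<in> ?V" "\<exists>n\<ge>N. f = m n" using eventually_happens'[OF \<beta>] by blast
    then show "\<exists>n\<ge>N. \<forall>D\<in>J. \<bar>m n D - \<beta> D\<bar> < e" by auto
  qed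
qed

text \<open>The extension starts from rectangles because these can be approximated by compact sets
  using nothing but the marginals. The semiring property rests on cutting a difference first along
  \<open>A'\<close>, then along \<open>B'\<close>.\<close>

lemma rectangles_semiring:
  "semiring_of_sets UNIV {A \<times> B | A B. A \<in> sets (borel :: 'a::topological_space measure) \<and> B \<in> sets (borel :: 'b::topological_space measure)}"
    (is "semiring_of_sets _ ?M")
proof
  show "?M \<subseteq> Pow UNIV" by simp
  show "{} \<in> ?M" by (rule CollectI, rule exI[of _ "{}"], rule exI[of _ "{}"]) auto
  fix X Y assume "X \<in> ?M" "Y \<in> ?M"
  then obtain A B A' B' where X: "X = A \<times> B" "A \<in> sets borel" "B \<in> sets borel"
    and Y: "Y = A' \<times> B'" "A' \<in> sets borel" "B' \<in> sets borel" by blast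
  have "X \<inter> Y = (A \<inter> A') \<times> (B \<inter> B')" unfolding X Y by auto
  then show "X \<inter> Y \<in> ?M" using X Y by blast
  have "X - Y = \<Union>{(A - A') \<times> B, (A \<inter> A') \<times> (B - B')}" unfolding X Y by auto
  moreover have "disjoint {(A - A') \<times> B, (A \<inter> A') \<times> (B - B')}"
    by (auto simp: disjoint_def)
  moreover have "(A - A') \<times> B \<in> ?M" "(A \<inter> A') \<times> (B - B') \<in> ?M"
    using X Y by blast+
  then have "{(A - A') \<times> B, (A \<inter> A') \<times> (B - B')} \<subseteq> ?M" by blast
  ultimately show "\<exists>C\<subseteq>?M. finite C \<and> disjoint C \<and> X - Y = \<Union>C" by blast
qed

text \<open>
  A finitely additive function with countably additive, hence tight, marginals is continuous at
  the empty set on finite unions of rectangles.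
\<close>

lemma finitely_additive_coupling_extension:
  fixes \<mu> :: "'a::polish_space measure" and \<nu> :: "'b::polish_space measure"
    and \<beta> :: "('a \<times> 'b) set \<Rightarrow> real"
  assumes \<mu>: "finite_measure \<mu>" "sets \<mu> = sets borel" and \<nu>: "finite_measure \<nu>" "sets \<nu> = sets borel"
    and nonneg: "\<And>A. A \<in> sets borel \<Longrightarrow> \<beta> A \<ge> 0"
    and add: "\<And>A B. A \<in> sets borel \<Longrightarrow> B \<in> sets borel \<Longrightarrow> A \<inter> B = {} \<Longrightarrow> \<beta> (A \<union> B) = \<beta> A + \<beta> B"
    and marg: "\<And>A. A \<in> sets borel \<Longrightarrow> \<beta> (A \<times> UNIV) = measure \<mu> A"
      "\<And>B. B \<in> sets borel \<Longrightarrow> \<beta> (UNIV \<times> B) = measure \<nu> B"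
  obtains \<gamma> where "\<gamma> \<in> couplings \<mu> \<nu>" "\<And>U. open U \<Longrightarrow> emeasure \<gamma> U \<le> ennreal (\<beta> U)"
proof -
  interpret \<mu>: finite_measure \<mu> by fact
  interpret \<nu>: finite_measure \<nu> by fact
  let ?M = "{A \<times> B | A B. A \<in> sets (borel :: 'a measure) \<and> B \<in> sets (borel :: 'b measure)}"
  interpret S: semiring_of_sets UNIV ?M by (rule rectangles_semiring)
  let ?R = "S.generated_ring"
  interpret R: ring_of_sets UNIV ?R by (rule S.generating_ring)
  have MI: "A \<times> B \<in> ?M" if "A \<in> sets borel" "B \<in> sets borel" for A B
    by (intro CollectI, rule exI[of _ A], rule exI[of _ B]) (simp add: that)
  have Mb: "X \<in> sets borel" if "X \<in> ?M" for X using that by (auto intro: borel_Times)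
  have Rb: "X \<in> sets borel" if X: "X \<in> ?R" for X
    by (rule S.generated_ringE[OF X]) (use Mb in \<open>auto intro!: sets.countable_Union countable_finite\<close>)
  have empty: "\<beta> {} = 0" using add[of "{}" "{}"] by simp
  have mono: "\<beta> A \<le> \<beta> B" if "A \<subseteq> B" "A \<in> sets borel" "B \<in> sets borel" for A B
    using add[of A "B - A"] nonneg[of "B - A"] that by (auto simp: Un_absorb1)
  have subadd: "\<beta> (A \<union> B) \<le> \<beta> A + \<beta> B" if "A \<in> sets borel" "B \<in> sets borel" for A B
    using add[of A "B - A"] mono[of "B - A" B] that by auto
  have subadd_UN: "\<beta> (\<Union>i\<in>I. D i) \<le> (\<Sum>i\<in>I. \<beta> (D i))" if "finite I" "\<And>i. i \<in> I \<Longrightarrow> D i \<in> sets borel" for I :: "nat set" and D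
    using that
  proof (induction I rule: finite_induct)
    case (insert i I)
    have "\<beta> (D i \<union> (\<Union>i\<in>I. D i)) \<le> \<beta> (D i) + \<beta> (\<Union>i\<in>I. D i)"
      using insert by (intro subadd sets.finite_UN) auto
    then show ?case using insert by auto
  qed (simp add: empty)
  \<comment> \<open>What \<open>K \<times> L\<close> misses of the rectangle lies in two strips, and
    the masses of strips are marginal masses.\<close>
  have rect: "\<exists>C. compact C \<and> C \<subseteq> X \<and> \<beta> (X - C) \<le> e" if X: "X \<in> ?M" and e: "e > 0" for X e
  proof -
    obtain A B where AB: "X = A \<times> B" "A \<in> sets borel" "B \<in> sets borel" using X by blast
    have e2: "e / 2 > 0" using e by simp
    obtain K where K: "K \<subseteq> A" "compact K" "measure \<mu> (A - K) < e / 2"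
      by (rule ex_compact_measure_Diff_less[OF \<mu> AB(2) e2])
    obtain L where L: "L \<subseteq> B" "compact L" "measure \<nu> (B - L) < e / 2"
      by (rule ex_compact_measure_Diff_less[OF \<nu> AB(3) e2])
    have b: "A - K \<in> sets borel" "B - L \<in> sets borel"
      using AB K L by (simp_all add: sets.Diff borel_closed compact_imp_closed)
    have c: "compact (K \<times> L)" using K L by (intro compact_Times)
    have "\<beta> (X - K \<times> L) \<le> \<beta> ((A - K) \<times> UNIV \<union> UNIV \<times> (B - L))"
      using b Mb[OF X] c unfolding AB(1)
      by (intro mono sets.Un sets.Diff[OF _ borel_closed[OF compact_imp_closed[OF c]]] borel_Times[OF _ b(2)] borel_Times[OF b(1)]) auto
    also have "\<dots> \<le> \<beta> ((A - K) \<times> UNIV) + \<beta> (UNIV \<times> (B - L))"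
      using b by (intro subadd borel_Times) auto
    also have "\<dots> \<le> e" using K L by (simp add: marg b)
    finally show ?thesis using c K L AB by (intro exI[of _ "K \<times> L"]) auto
  qed
  have approx: "\<exists>C. compact C \<and> C \<subseteq> X \<and> \<beta> (X - C) \<le> e" if X: "X \<in> ?R" and e: "e > 0" for X e
  proof -
    obtain \<C> where \<C>: "X = \<Union>\<C>" "finite \<C>" "\<C> \<subseteq> ?M" by (rule S.generated_ringE[OF X]) blast
    \<comment> \<open>The tolerance is split between the new rectangle and the rest, so the
      induction hypothesis is needed for every \<open>e\<close>.\<close>
    have "\<forall>e>0. \<exists>C. compact C \<and> C \<subseteq> \<Union>\<C> \<and> \<beta> (\<Union>\<C> - C) \<le> e" using \<C>(2,3)
    proof (induction \<C> rule: finite_induct)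
      case empty
      then show ?case using \<open>\<beta> {} = 0\<close> by (auto intro!: exI[of _ "{}"])
    next
      case (insert Y \<C>)
      show ?case
      proof (intro allI impI)
        fix e :: real assume e: "e > 0"
        obtain C1 where C1: "compact C1" "C1 \<subseteq> Y" "\<beta> (Y - C1) \<le> e / 2"
          using rect[of Y "e / 2"] insert e by auto
        have e2: "e / 2 > 0" using e by simp
        have "\<C> \<subseteq> ?M" using insert.prems by blast
        from insert.IH[OF this, rule_format, OF e2]
        have "\<exists>C. compact C \<and> C \<subseteq> \<Union>\<C> \<and> \<beta> (\<Union>\<C> - C) \<le> e / 2" .
        then obtain C2 where C2: "compact C2" "C2 \<subseteq> \<Union>\<C>" "\<beta> (\<Union>\<C> - C2) \<le> e / 2" by blast
        have Yb: "Y \<in> sets borel" using insert Mb by auto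
        have "\<C> \<subseteq> sets borel" using \<open>\<C> \<subseteq> ?M\<close> Mb by blast
        then have Cb: "\<Union>\<C> \<in> sets borel"
          by (rule sets.countable_Union[OF countable_finite[OF insert.hyps(1)]])
        have b: "Y - C1 \<in> sets borel" "\<Union>\<C> - C2 \<in> sets borel" "\<Union>(insert Y \<C>) - (C1 \<union> C2) \<in> sets borel"
          using Yb Cb C1 C2 by (simp_all add: sets.Diff sets.Un borel_closed compact_imp_closed compact_Un)
        have "\<beta> (\<Union>(insert Y \<C>) - (C1 \<union> C2)) \<le> \<beta> ((Y - C1) \<union> (\<Union>\<C> - C2))"
          using b by (intro mono) auto
        also have "\<dots> \<le> e" using subadd[OF b(1,2)] C1 C2 by linarith
        finally show "\<exists>C. compact C \<and> C \<subseteq> \<Union>(insert Y \<C>) \<and> \<beta> (\<Union>(insert Y \<C>) - C) \<le> e"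
          using C1 C2 by (intro exI[of _ "C1 \<union> C2"]) (auto intro: compact_Un)
      qed
    qed
    then show ?thesis using e \<C>(1) by blast
  qed
  have cont: "(\<lambda>i. ennreal (\<beta> (A i))) \<longlonglongrightarrow> 0"
    if A: "range A \<subseteq> ?R" "decseq A" "(\<Inter>i. A i) = {}" for A
  proof -
    have Ab: "A i \<in> sets borel" for i using A(1) Rb by auto
    have "(\<lambda>i. \<beta> (A i)) \<longlonglongrightarrow> 0"
    proof (rule LIMSEQ_I)
      fix r :: real assume r: "r > 0"
      \<comment> \<open>With these tolerances the errors add up to less than
        \<open>r / 2\<close>.\<close>
      have "\<forall>i. \<exists>C. compact C \<and> C \<subseteq> A i \<and> \<beta> (A i - C) \<le> r * (1/2) ^ Suc (Suc i)"
      proof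
        fix i
        have "r * (1/2) ^ Suc (Suc i) > 0" using r by simp
        then show "\<exists>C. compact C \<and> C \<subseteq> A i \<and> \<beta> (A i - C) \<le> r * (1/2) ^ Suc (Suc i)"
          using A(1) by (intro approx) auto
      qed
      then obtain C where C: "\<And>i. compact (C i)" "\<And>i. C i \<subseteq> A i" "\<And>i. \<beta> (A i - C i) \<le> r * (1/2) ^ Suc (Suc i)"
        by metis
      have "(\<Inter>i. C i) \<subseteq> (\<Inter>i. A i)" by (rule INF_mono') (rule C(2))
      then have "C 0 \<inter> (\<Inter>i\<in>UNIV. C i) = {}" unfolding A(3) by simp
      moreover have "closed (C i)" for i using C(1) by (rule compact_imp_closed)
      \<comment> \<open>The compact sets \<open>C i\<close> have empty intersection, so finitely
        many of them already do. \<open>C 0\<close> is the ambient compact set, which is why 0 is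
        inserted into \<open>I\<close> below.\<close>
      ultimately have "\<not> (\<forall>I. finite I \<longrightarrow> C 0 \<inter> (\<Inter>i\<in>I. C i) \<noteq> {})"
        using compact_imp_fip_image[OF C(1)[of 0], of UNIV C] by fastforce
      then obtain I where I: "finite I" "C 0 \<inter> (\<Inter>i\<in>I. C i) = {}" by blast
      define N where "N = Max (insert 0 I)"
      have N: "i \<le> N" if "i \<in> insert 0 I" for i unfolding N_def using that I(1) by (intro Max_ge) auto
      have "\<beta> (A n) < r" if n: "n \<ge> N" for n
      proof -
        \<comment> \<open>A point of \<open>A n\<close> is missed by some \<open>C i\<close> with
          \<open>i \<le> N\<close>, and it lies in \<open>A i\<close> because the sequence
          decreases. So only the errors contribute.\<close>
        have "A n \<subseteq> (\<Union>i\<in>{..N}. A i - C i)"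
        proof
          fix x assume x: "x \<in> A n"
          obtain i where i: "i \<in> insert 0 I" "x \<notin> C i" using I(2) by blast
          have "A n \<subseteq> A i" using N[OF i(1)] n by (intro decseqD[OF A(2)]) auto
          then have "x \<in> A i" using x by auto
          then show "x \<in> (\<Union>i\<in>{..N}. A i - C i)" using i N[OF i(1)] by auto
        qed
        moreover have Cb: "A i - C i \<in> sets borel" for i
          using Ab C(1) by (simp add: sets.Diff borel_closed compact_imp_closed)
        ultimately have "\<beta> (A n) \<le> \<beta> (\<Union>i\<in>{..N}. A i - C i)"
          using Ab by (intro mono sets.finite_UN) auto
        also have "\<dots> \<le> (\<Sum>i\<le>N. \<beta> (A i - C i))" using Cb by (intro subadd_UN) auto
        also have "\<dots> \<le> (\<Sum>i\<le>N. r / 4 * (1/2) ^ i)" using C(3) by (intro sum_mono) simp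
        also have "\<dots> = r / 4 * (\<Sum>i\<le>N. (1/2) ^ i)" by (rule sum_distrib_left[symmetric])
        also have "(\<Sum>i\<le>N. (1/2) ^ i) < (2::real)" by (subst sum_gp0) simp
        then have "r / 4 * (\<Sum>i\<le>N. (1/2) ^ i) < r" using r by (simp add: field_simps)
        finally show ?thesis .
      qed
      then show "\<exists>no. \<forall>n\<ge>no. norm (\<beta> (A n) - 0) < r"
        using nonneg[OF Ab] by (intro exI[of _ N]) auto
    qed
    then show ?thesis using tendsto_ennrealI by fastforce
  qed
  have "\<exists>\<mu>'. (\<forall>s \<in> ?R. \<mu>' s = ennreal (\<beta> s)) \<and> measure_space UNIV (sigma_sets UNIV ?R) \<mu>'"
  proof (rule R.caratheodory_empty_continuous)
    show "positive ?R (\<lambda>s. ennreal (\<beta> s))" by (simp add: positive_def empty)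
    show "additive ?R (\<lambda>s. ennreal (\<beta> s))"
      by (auto simp: additive_def add Rb nonneg ennreal_plus)
  qed (use cont in auto)
  then obtain \<mu>' where \<mu>': "\<And>s. s \<in> ?R \<Longrightarrow> \<mu>' s = ennreal (\<beta> s)" "measure_space UNIV (sigma_sets UNIV ?R) \<mu>'"
    by blast
  \<comment> \<open>The ring generates the product sigma-algebra, which is the Borel one by second
    countability of both factors.\<close>
  have "sigma_sets UNIV ?R = sigma_sets UNIV ?M" by (rule S.sigma_sets_generated_ring_eq)
  also have "\<dots> = sets ((borel :: 'a measure) \<Otimes>\<^sub>M (borel :: 'b measure))"
    by (simp only: sets_pair_measure space_borel UNIV_Times_UNIV)
  also have "\<dots> = sets borel" by (simp only: borel_prod)
  finally have sigma: "sigma_sets UNIV ?R = sets borel" .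
  define \<gamma> where "\<gamma> = measure_of UNIV (sets borel) \<mu>'"
  have sets\<gamma>: "sets \<gamma> = sets borel" unfolding \<gamma>_def using sets.sigma_sets_eq[of borel] by (simp add: sets_measure_of)
  have em: "emeasure \<gamma> X = \<mu>' X" if "X \<in> sets borel" for X
    unfolding \<gamma>_def using \<mu>'(2) that unfolding sigma measure_space_def by (intro emeasure_measure_of_sigma) auto
  have spd: "space \<gamma> = UNIV" using sets_eq_imp_space_eq[OF sets\<gamma>] by simp
  have fs: "fst \<in> measurable \<gamma> borel" "snd \<in> measurable \<gamma> borel"
    unfolding measurable_cong_sets[OF sets\<gamma> refl]
    by (auto intro!: borel_measurable_continuous_onI continuous_on_fst continuous_on_snd continuous_on_id)
  have "distr \<gamma> borel fst = \<mu>"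
  proof (rule measure_eqI)
    fix A assume "A \<in> sets (distr \<gamma> borel fst)"
    then have A: "A \<in> sets borel" by simp
    have "A \<times> UNIV \<in> ?M" using A by (intro MI) auto
    then have "A \<times> UNIV \<in> ?R" by (rule S.generated_ringI_Basic)
    moreover have "fst -` A = A \<times> (UNIV :: 'b set)" by auto
    ultimately show "emeasure (distr \<gamma> borel fst) A = emeasure \<mu> A"
      using A by (simp add: emeasure_distr[OF fs(1)] spd em Rb \<mu>'(1) marg \<mu>.emeasure_eq_measure)
  qed (simp add: \<mu>)
  moreover have "distr \<gamma> borel snd = \<nu>"
  proof (rule measure_eqI)
    fix A assume "A \<in> sets (distr \<gamma> borel snd)"
    then have A: "A \<in> sets borel" by simp
    have "UNIV \<times> A \<in> ?M" using A by (intro MI) auto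
    then have "UNIV \<times> A \<in> ?R" by (rule S.generated_ringI_Basic)
    moreover have "snd -` A = (UNIV :: 'a set) \<times> A" by auto
    ultimately show "emeasure (distr \<gamma> borel snd) A = emeasure \<nu> A"
      using A by (simp add: emeasure_distr[OF fs(2)] spd em Rb \<mu>'(1) marg \<nu>.emeasure_eq_measure)
  qed (simp add: \<nu>)
  ultimately have \<gamma>: "\<gamma> \<in> couplings \<mu> \<nu>" unfolding couplings_def using sets\<gamma> by simp
  \<comment> \<open>An open set is an increasing union of finite unions of basic rectangles, where
    \<gamma> and \<beta> agree. Continuity from below holds for \<gamma>; for \<beta> only
    monotonicity is available, hence an inequality.\<close>
  have "emeasure \<gamma> U \<le> ennreal (\<beta> U)" if U: "open U" for U
  proof -
    obtain \<A> :: "'a set set" where \<A>: "countable \<A>" "topological_basis \<A>" using ex_countable_basis by blast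
    obtain \<B> :: "'b set set" where \<B>: "countable \<B>" "topological_basis \<B>" using ex_countable_basis by blast
    let ?\<P> = "(\<lambda>(a, b). a \<times> b) ` (\<A> \<times> \<B>)"
    obtain \<U> where \<U>: "\<U> \<subseteq> ?\<P>" "\<Union>\<U> = U"
      using topological_basis_prod[OF \<A>(2) \<B>(2)] U unfolding topological_basis_def by metis
    have "countable \<U>" using \<A>(1) \<B>(1) by (intro countable_subset[OF \<U>(1)]) simp
    have PR: "X \<in> ?R" if "X \<in> \<U>" for X
    proof (rule S.generated_ringI_Basic)
      have "X \<in> ?\<P>" using \<U>(1) that by (rule subsetD)
      then obtain a b where X: "X = a \<times> b" "a \<in> \<A>" "b \<in> \<B>" by auto
      show "X \<in> ?M" unfolding X(1)
        using topological_basis_open[OF \<A>(2) X(2)] topological_basis_open[OF \<B>(2) X(3)] by (intro MI) auto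
    qed
    show ?thesis
    proof (cases "\<U> = {}")
      case False
      define F where "F = from_nat_into \<U>"
      have F: "range F = \<U>" unfolding F_def using False \<open>countable \<U>\<close> by (rule range_from_nat_into)
      define V where "V n = (\<Union>i\<in>{..n}. F i)" for n
      have "F i \<in> ?R" for i using F by (intro PR) auto
      then have VR: "V n \<in> ?R" for n unfolding V_def by (intro R.finite_UN) auto
      have "(\<Union>n. V n) = U" unfolding V_def using F \<U>(2) by auto
      moreover have "incseq V" unfolding V_def incseq_def by force
      ultimately have "emeasure \<gamma> U = (SUP n. emeasure \<gamma> (V n))"
        using SUP_emeasure_incseq[of V \<gamma>] Rb[OF VR] by (simp add: sets\<gamma> image_subset_iff)
      also have "\<dots> \<le> ennreal (\<beta> U)"
      proof (rule SUP_least)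
        fix n
        have "V n \<subseteq> U" using \<open>(\<Union>n. V n) = U\<close> by auto
        then have "\<beta> (V n) \<le> \<beta> U" using U by (intro mono Rb[OF VR]) auto
        then show "emeasure \<gamma> (V n) \<le> ennreal (\<beta> U)"
          by (simp add: em[OF Rb[OF VR]] \<mu>'(1)[OF VR] ennreal_leI)
      qed
      finally show ?thesis .
    qed (use \<U> in auto)
  qed
  then show ?thesis by (rule that[OF \<gamma>])
qed

text \<open>A discrete layer cake formula: the slab of \<open>u\<close> between two consecutive
  levels lies between \<open>h\<close> times the indicators of its upper and its lower superlevel
  set. It turns bounds on superlevel sets into bounds on integrals with error
  \<open>h\<close>.\<close>

lemma layer_cake_bounds:
  fixes u :: "'z \<Rightarrow> real"
  assumes M: "prob_space M" and u: "u \<in> borel_measurable M" and bound: "\<And>z. 0 \<le> u z" "\<And>z. u z \<le> real n * h"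
    and h: "h > 0"
  shows "(LINT z|M. u z) \<le> h * (\<Sum>k<n. measure M {z \<in> space M. real k * h < u z})" (is "?I \<le> ?S")
    and "h * (\<Sum>k<n. measure M {z \<in> space M. real k * h < u z}) \<le> (LINT z|M. u z) + h"
proof -
  interpret prob_space M by fact
  let ?L = "\<lambda>k. {z \<in> space M. real k * h < u z}"
  have L: "?L k \<in> sets M" for k using u by measurable
  have int_L: "(LINT z|M. h * (\<Sum>k<n. indicator (?L (f k)) z)) = h * (\<Sum>k<n. measure M (?L (f k)))" for f
    using L by (subst Bochner_Integration.integral_mult_right_zero, subst Bochner_Integration.integral_sum) (auto simp: emeasure_eq_measure)
  have int_u: "integrable M u"
    using u bound by (intro integrable_const_bound[of _ "real n * h"]) auto
  have int_S: "integrable M (\<lambda>z. h * (\<Sum>k<n. indicator (?L (f k)) z))" for f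
    using L by (intro integrable_mult_right Bochner_Integration.integrable_sum) (auto simp: emeasure_eq_measure)
  \<comment> \<open>Truncation at level 0 gives 0 and truncation at level \<open>n\<close> gives
    \<open>u z\<close>, by the two bounds on \<open>u\<close>.\<close>
  have tele: "u z = (\<Sum>k<n. min (u z) (real (Suc k) * h) - min (u z) (real k * h))" for z
    using bound[of z] sum_lessThan_telescope[of "\<lambda>k. min (u z) (real k * h)" n] by (simp add: min_def split: if_splits)
  have up: "u z \<le> h * (\<Sum>k<n. indicator (?L k) z)" if "z \<in> space M" for z
  proof -
    have "(\<Sum>k<n. min (u z) (real (Suc k) * h) - min (u z) (real k * h)) \<le> (\<Sum>k<n. h * indicator (?L k) z)"
      using h that by (intro sum_mono) (auto simp: indicator_def min_def algebra_simps)
    then show ?thesis using tele[of z] by (simp add: sum_distrib_left)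
  qed
  have lo: "h * (\<Sum>k<n. indicator (?L (Suc k)) z) \<le> u z" if "z \<in> space M" for z
  proof -
    have "(\<Sum>k<n. h * indicator (?L (Suc k)) z) \<le> (\<Sum>k<n. min (u z) (real (Suc k) * h) - min (u z) (real k * h))"
      using h that by (intro sum_mono) (auto simp: indicator_def min_def algebra_simps)
    then show ?thesis using tele[of z] by (simp add: sum_distrib_left)
  qed
  have "(LINT z|M. u z) \<le> (LINT z|M. h * (\<Sum>k<n. indicator (?L k) z))"
    using up by (intro integral_mono int_u int_S)
  then show "?I \<le> ?S" unfolding int_L[of "\<lambda>k. k"] .
  have "(LINT z|M. h * (\<Sum>k<n. indicator (?L (Suc k)) z)) \<le> (LINT z|M. u z)"
    using lo by (intro integral_mono int_u int_S)
  then have "h * (\<Sum>k<n. measure M (?L (Suc k))) \<le> (LINT z|M. u z)" unfolding int_L .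
  \<comment> \<open>Shifting the levels by one loses only the lowest term, at most 1 for a
    probability measure.\<close>
  moreover have "(\<Sum>k<n. measure M (?L k)) \<le> (\<Sum>k<n. measure M (?L (Suc k))) + 1"
  proof -
    define a where "a k = measure M (?L k)" for k
    have "a 0 \<le> 1" "a n \<ge> 0" unfolding a_def by (rule prob_le_1, rule measure_nonneg)
    then have "(\<Sum>k<n. a k) \<le> (\<Sum>k<n. a (Suc k)) + 1"
      using sum.lessThan_Suc_shift[of a n] sum.lessThan_Suc[of a n] by linarith
    then show ?thesis unfolding a_def .
  qed
  then have "h * (\<Sum>k<n. measure M (?L k)) \<le> h * ((\<Sum>k<n. measure M (?L (Suc k))) + 1)"
    using h by (intro mult_left_mono) auto
  ultimately show "h * (\<Sum>k<n. measure M (?L k)) \<le> (LINT z|M. u z) + h" by (simp add: algebra_simps)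
qed

text \<open>Ensures that the infimum of the costs is taken over a nonempty set.\<close>

lemma product_coupling:
  fixes \<mu> :: "'a::second_countable_topology measure" and \<nu> :: "'b::second_countable_topology measure"
  assumes "prob_space \<mu>" "sets \<mu> = sets borel" "prob_space \<nu>" "sets \<nu> = sets borel"
  shows "\<mu> \<Otimes>\<^sub>M \<nu> \<in> couplings \<mu> \<nu>"
proof -
  interpret \<mu>: prob_space \<mu> by fact
  interpret \<nu>: prob_space \<nu> by fact
  interpret pair_prob_space \<mu> \<nu> ..
  have "sets (\<mu> \<Otimes>\<^sub>M \<nu>) = sets ((borel :: 'a measure) \<Otimes>\<^sub>M (borel :: 'b measure))"
    using assms by (intro sets_pair_measure_cong) auto
  then have 1: "sets (\<mu> \<Otimes>\<^sub>M \<nu>) = sets borel" by (simp only: borel_prod)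
  have "distr (\<mu> \<Otimes>\<^sub>M \<nu>) borel fst = distr (\<mu> \<Otimes>\<^sub>M \<nu>) \<mu> fst"
    using assms by (intro distr_cong) auto
  then have 2: "distr (\<mu> \<Otimes>\<^sub>M \<nu>) borel fst = \<mu>" by (simp add: \<nu>.distr_pair_fst)
  have "distr (\<mu> \<Otimes>\<^sub>M \<nu>) borel snd = distr (\<mu> \<Otimes>\<^sub>M \<nu>) \<nu> snd"
    using assms by (intro distr_cong) auto
  also have "\<dots> = \<nu>"
  proof (rule measure_eqI)
    fix A assume "A \<in> sets (distr (\<mu> \<Otimes>\<^sub>M \<nu>) \<nu> snd)"
    then have A: "A \<in> sets \<nu>" by simp
    have "snd -` A \<inter> space (\<mu> \<Otimes>\<^sub>M \<nu>) = space \<mu> \<times> A"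
      using sets.sets_into_space[OF A] by (auto simp: space_pair_measure)
    then show "emeasure (distr (\<mu> \<Otimes>\<^sub>M \<nu>) \<nu> snd) A = emeasure \<nu> A"
      using A by (simp add: emeasure_distr \<nu>.emeasure_pair_measure_Times \<mu>.emeasure_space_1)
  qed simp
  finally show ?thesis unfolding couplings_def using 1 2 by simp
qed

text \<open>Superlevel sets of a continuous cost are open, and there \<gamma> lies below the cluster
  function of a minimizing sequence. Summing over levels gives lower semicontinuity of the cost
  along this sequence.\<close>

lemma ex_optimal_coupling:
  fixes \<mu> :: "'a::polish_space measure" and \<nu> :: "'b::polish_space measure" and c :: "'a \<times> 'b \<Rightarrow> real"
  assumes \<mu>: "prob_space \<mu>" "sets \<mu> = sets borel" and \<nu>: "prob_space \<nu>" "sets \<nu> = sets borel"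
    and c: "continuous_on UNIV c" "bounded (range c)"
  obtains \<gamma> where "\<gamma> \<in> couplings \<mu> \<nu>" "\<And>\<delta>. \<delta> \<in> couplings \<mu> \<nu> \<Longrightarrow> (LINT p|\<gamma>. c p) \<le> (LINT p|\<delta>. c p)"
proof -
  interpret \<mu>: prob_space \<mu> by fact
  interpret \<nu>: prob_space \<nu> by fact
  obtain B where B: "\<And>z. \<bar>c z\<bar> \<le> B" "B > 0" using c(2) by (auto simp: bounded_pos)
  \<comment> \<open>The shift makes the cost nonnegative, as the layer cake requires; it changes the
    cost of every coupling by the same constant.\<close>
  define u where "u z = c z + B" for z
  have u: "0 \<le> u z" "u z \<le> 2 * B" for z using B(1)[of z] by (auto simp: u_def)
  have u_cont: "continuous_on UNIV u" unfolding u_def using c by (intro continuous_intros)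
  have prob: "prob_space \<delta>" if "\<delta> \<in> couplings \<mu> \<nu>" for \<delta> by (rule couplings_prob_space[OF that \<mu>(1)])
  have LINT_u: "(LINT p|\<delta>. u p) = (LINT p|\<delta>. c p) + B" if "\<delta> \<in> couplings \<mu> \<nu>" for \<delta>
  proof -
    interpret prob_space \<delta> by (rule prob[OF that])
    show ?thesis unfolding u_def using couplings_integrable[OF that \<mu>(1) c]
      by (subst Bochner_Integration.integral_add) (auto simp: prob_space)
  qed
  let ?V = "(\<lambda>\<delta>. LINT p|\<delta>. u p) ` couplings \<mu> \<nu>"
  have bdd: "bdd_below ?V" by (rule bdd_belowI2[of _ 0]) (simp add: u)
  have ne: "?V \<noteq> {}" using product_coupling[OF \<mu> \<nu>] by auto
  have "\<exists>\<delta>\<in>couplings \<mu> \<nu>. (LINT p|\<delta>. u p) < Inf ?V + 1 / Suc n" for n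
    using cInf_lessD[OF ne, of "Inf ?V + 1 / Suc n"] by auto
  then obtain g where g: "\<And>n. g n \<in> couplings \<mu> \<nu>" "\<And>n. (LINT p|g n. u p) < Inf ?V + 1 / Suc n"
    by metis
  have "measure (g n) D \<in> {0..1}" for n D
    using prob_space.prob_le_1[OF prob[OF g(1)]] by simp
  from ex_cluster_function[of "\<lambda>n. measure (g n)", OF this] obtain \<beta>
    where \<beta>: "\<And>J e N. finite J \<Longrightarrow> e > 0 \<Longrightarrow> \<exists>n\<ge>N. \<forall>D\<in>J. \<bar>measure (g n) D - \<beta> D\<bar> < e" by blast
  have \<beta>_nonneg: "0 \<le> \<beta> U" for U
  proof (rule field_le_epsilon)
    fix e :: real assume "e > 0"
    then obtain n where "\<bar>measure (g n) U - \<beta> U\<bar> < e" using \<beta>[of "{U}" e 0] by auto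
    then show "0 \<le> \<beta> U + e" using measure_nonneg[of "g n" U] by linarith
  qed
  obtain \<gamma> where \<gamma>: "\<gamma> \<in> couplings \<mu> \<nu>" "\<And>U. open U \<Longrightarrow> emeasure \<gamma> U \<le> ennreal (\<beta> U)"
  proof (rule finitely_additive_coupling_extension[of \<mu> \<nu> \<beta>])
    show "\<beta> A \<ge> 0" for A by (rule \<beta>_nonneg)
    \<comment> \<open>A constant sequence has only one cluster value, and all couplings share their
      marginals.\<close>
    have eqI: "\<beta> A = r" if "\<And>n. measure (g n) A = r" for A r
    proof -
      have "\<bar>r - \<beta> A\<bar> \<le> 0 + e" if "e > 0" for e using \<beta>[of "{A}" e 0] that \<open>\<And>n. measure (g n) A = r\<close> by auto
      then have "\<bar>r - \<beta> A\<bar> \<le> 0" by (rule field_le_epsilon)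
      then show ?thesis by simp
    qed
    show "\<beta> (A \<times> UNIV) = measure \<mu> A" if "A \<in> sets borel" for A
      using couplings_emeasure(1)[OF g(1) that] by (intro eqI) (simp add: measure_def)
    show "\<beta> (UNIV \<times> A) = measure \<nu> A" if "A \<in> sets borel" for A
      using couplings_emeasure(2)[OF g(1) that] by (intro eqI) (simp add: measure_def)
    show "\<beta> (X \<union> Y) = \<beta> X + \<beta> Y" if XY: "X \<in> sets borel" "Y \<in> sets borel" "X \<inter> Y = {}" for X Y
    proof -
      have "\<bar>\<beta> (X \<union> Y) - \<beta> X - \<beta> Y\<bar> \<le> 0 + e" if "e > 0" for e
      proof -
        have "e / 3 > 0" using that by simp
        then obtain n where n: "\<bar>measure (g n) X - \<beta> X\<bar> < e / 3" "\<bar>measure (g n) Y - \<beta> Y\<bar> < e / 3"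
          "\<bar>measure (g n) (X \<union> Y) - \<beta> (X \<union> Y)\<bar> < e / 3" using \<beta>[of "{X, Y, X \<union> Y}" "e / 3" 0] by auto
        interpret g: prob_space "g n" by (rule prob[OF g(1)])
        have "measure (g n) (X \<union> Y) = measure (g n) X + measure (g n) Y"
          using XY couplings_space(1)[OF g(1)] by (intro g.finite_measure_Union) auto
        then show ?thesis using n by (simp add: abs_if split: if_splits)
      qed
      then have "\<bar>\<beta> (X \<union> Y) - \<beta> X - \<beta> Y\<bar> \<le> 0" by (rule field_le_epsilon)
      then show ?thesis by simp
    qed
  qed (use \<mu> \<nu> \<mu>.finite_measure_axioms \<nu>.finite_measure_axioms in auto)
  have \<gamma>_le: "measure \<gamma> U \<le> \<beta> U" if "open U" for U
    using \<gamma>(2)[OF that] \<beta>_nonneg[of U] unfolding measure_def by (simp add: enn2real_leI)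
  have u_meas: "u \<in> borel_measurable \<delta>" if "\<delta> \<in> couplings \<mu> \<nu>" for \<delta>
    unfolding measurable_cong_sets[OF couplings_space(1)[OF that] refl]
    by (rule borel_measurable_continuous_onI[OF u_cont])
  have "(LINT p|\<gamma>. u p) \<le> Inf ?V + (1 + 4 * B) / Suc N" for N
  proof -
    \<comment> \<open>\<open>Suc N\<close> slabs of height \<open>h\<close> fill
      \<open>[0, 2 * B]\<close>. Passing from \<gamma> to \<open>g n\<close> costs
      \<open>1 / Suc N\<close> per level, in total \<open>h\<close>; the layer cake costs another
      \<open>h\<close>, and \<open>g n\<close> itself is \<open>1 / Suc N\<close> above the
      infimum.\<close>
    define h where "h = 2 * B / Suc N"
    have h: "h > 0" "real (Suc N) * h = 2 * B" using B(2) by (auto simp: h_def)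
    let ?U = "\<lambda>k. {z. real k * h < u z}"
    have open_U: "open (?U k)" for k using u_cont by (intro open_Collect_less continuous_intros)
    obtain n where n: "n \<ge> N" "\<And>k. k < Suc N \<Longrightarrow> \<bar>measure (g n) (?U k) - \<beta> (?U k)\<bar> < 1 / Suc N"
      using \<beta>[of "?U ` {..<Suc N}" "1 / Suc N" N] by auto
    have sp: "{z \<in> space \<delta>. real k * h < u z} = ?U k" if "\<delta> \<in> couplings \<mu> \<nu>" for \<delta> k
      using couplings_space(2)[OF that] by simp
    have 1: "(LINT p|\<gamma>. u p) \<le> h * (\<Sum>k<Suc N. measure \<gamma> (?U k))"
      using layer_cake_bounds(1)[OF prob[OF \<gamma>(1)] u_meas[OF \<gamma>(1)] u(1), of "Suc N" h] u(2) h
      by (simp only: sp[OF \<gamma>(1)])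
    have 2: "h * (\<Sum>k<Suc N. measure \<gamma> (?U k)) \<le> h * (\<Sum>k<Suc N. measure (g n) (?U k) + 1 / Suc N)"
    proof (intro mult_left_mono sum_mono)
      fix k assume "k \<in> {..<Suc N}"
      then show "measure \<gamma> (?U k) \<le> measure (g n) (?U k) + 1 / Suc N"
        using \<gamma>_le[OF open_U[of k]] n(2)[of k] by (simp add: abs_less_iff)
    qed (use h in simp)
    have "(\<Sum>k<Suc N. measure (g n) (?U k) + 1 / Suc N) = (\<Sum>k<Suc N. measure (g n) (?U k)) + 1"
      by (simp add: sum.distrib del: sum.lessThan_Suc)
    then have 3: "h * (\<Sum>k<Suc N. measure (g n) (?U k) + 1 / Suc N) = h * (\<Sum>k<Suc N. measure (g n) (?U k)) + h"
      by (simp only: distrib_left mult_1_right)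
    have 4: "h * (\<Sum>k<Suc N. measure (g n) (?U k)) \<le> (LINT p|g n. u p) + h"
      using layer_cake_bounds(2)[OF prob[OF g(1)] u_meas[OF g(1)] u(1), of "Suc N" h n] u(2) h
      by (simp only: sp[OF g(1)])
    have "1 / real (Suc n) \<le> 1 / Suc N" using n(1) by (intro divide_left_mono) auto
    with 1 2 3 4 g(2)[of n] have "(LINT p|\<gamma>. u p) \<le> Inf ?V + (1 / Suc N + 2 * h)" by linarith
    also have "1 / Suc N + 2 * h = (1 + 4 * B) / Suc N" by (simp add: h_def add_divide_distrib)
    finally show ?thesis .
  qed
  moreover have "(\<lambda>N. Inf ?V + (1 + 4 * B) / Suc N) \<longlonglongrightarrow> Inf ?V + 0"
    by (intro tendsto_add tendsto_const LIMSEQ_Suc lim_const_over_n)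
  ultimately have opt: "(LINT p|\<gamma>. u p) \<le> Inf ?V + 0" using LIMSEQ_le_const by blast
  show ?thesis
  proof (rule that[OF \<gamma>(1)])
    fix \<delta> assume \<delta>: "\<delta> \<in> couplings \<mu> \<nu>"
    then have "Inf ?V \<le> (LINT p|\<delta>. u p)" using bdd by (intro cInf_lower) auto
    then show "(LINT p|\<gamma>. c p) \<le> (LINT p|\<delta>. c p)" using opt LINT_u[OF \<delta>] LINT_u[OF \<gamma>(1)] by linarith
  qed
qed

section \<open>Charts\<close>

lemma C1_atlas_chart:
  assumes "C1_atlas E A" "(U, \<phi>) \<in> A"
  shows "open U" "openin (top_of_set E) (\<phi> ` U)" "continuous_on U \<phi>" "inj_on \<phi> U"
    "continuous_on (\<phi> ` U) (inv_into U \<phi>)"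
proof -
  have "is_chart E (U, \<phi>)" using assms unfolding C1_atlas_def by blast
  then have 1: "open U" "openin (top_of_set E) (\<phi> ` U)" "homeomorphism U (\<phi> ` U) \<phi> (inv_into U \<phi>)"
    unfolding is_chart_def by auto
  show "open U" "openin (top_of_set E) (\<phi> ` U)" by fact+
  show "continuous_on U \<phi>" "continuous_on (\<phi> ` U) (inv_into U \<phi>)"
    using 1(3) unfolding homeomorphism_def by auto
  show "inj_on \<phi> U" using 1(3) unfolding homeomorphism_def by (metis inj_on_inverseI)
qed

lemma C1_atlas_cover:
  assumes "C1_atlas E A"
  obtains U \<phi> where "(U, \<phi>) \<in> A" "x \<in> U"
  using assms unfolding C1_atlas_def by (metis (no_types, lifting) UNIV_I UN_E case_prod_beta' prod.collapse)

lemma C1_function_imp_continuous: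
  fixes c :: "'a::t2_space \<times> 'b::t2_space \<Rightarrow> real"
  assumes A: "C1_atlas E A" and B: "C1_atlas F B" and c: "C1_function (product_atlas A B) c"
  shows "continuous_on UNIV c"
proof -
  have "isCont c (x, y)" for x y
  proof -
    obtain U \<phi> where U: "(U, \<phi>) \<in> A" "x \<in> U" by (rule C1_atlas_cover[OF A])
    obtain V \<psi> where V: "(V, \<psi>) \<in> B" "y \<in> V" by (rule C1_atlas_cover[OF B])
    note U' = C1_atlas_chart[OF A U(1)] and V' = C1_atlas_chart[OF B V(1)]
    let ?f = "map_prod \<phi> \<psi>" and ?W = "U \<times> V"
    have "(?W, ?f) \<in> product_atlas A B" unfolding product_atlas_def using U(1) V(1) by blast
    then have "C1_on (?f ` ?W) (c \<circ> inv_into ?W ?f)" using c unfolding C1_function_def by blast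
    then obtain f' where f': "\<And>z. z \<in> ?f ` ?W \<Longrightarrow>
        ((c \<circ> inv_into ?W ?f) has_derivative blinfun_apply (f' z)) (at z within ?f ` ?W)"
      unfolding C1_on_def by blast
    then have "continuous_on (?f ` ?W) (c \<circ> inv_into ?W ?f)"
      by (rule has_derivative_continuous_on)
    moreover have "?f = (\<lambda>z. (\<phi> (fst z), \<psi> (snd z)))" by (simp add: fun_eq_iff)
    moreover have "continuous_on ?W (\<lambda>z. (\<phi> (fst z), \<psi> (snd z)))"
      by (rule continuous_on_Pair[OF continuous_on_compose2[OF U'(3) continuous_on_fst[OF continuous_on_id]]
            continuous_on_compose2[OF V'(3) continuous_on_snd[OF continuous_on_id]]]) auto
    ultimately have "continuous_on (?f ` ?W) (c \<circ> inv_into ?W ?f)" "continuous_on ?W ?f" by simp_all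
    then have "continuous_on ?W (\<lambda>z. (c \<circ> inv_into ?W ?f) (?f z))"
      by (rule continuous_on_compose2) simp
    moreover have "inj_on ?f ?W" using U'(4) V'(4) by (rule map_prod_inj_on)
    then have "(c \<circ> inv_into ?W ?f) (?f z) = c z" if "z \<in> ?W" for z using that by simp
    ultimately have "continuous_on ?W c" by (simp cong: continuous_on_cong)
    moreover have "open ?W" using U'(1) V'(1) by (rule open_Times)
    ultimately show ?thesis using U(2) V(2) by (simp add: continuous_on_eq_continuous_at)
  qed
  then show ?thesis by (auto intro!: continuous_at_imp_continuous_on)
qed

lemma chart_vimage_null:
  fixes A :: "('a::topological_space, 'e::euclidean_space) chart set"
  assumes A: "C1_atlas UNIV A" "(U, \<phi>) \<in> A" and ac: "ac_coordinate_measure UNIV A \<mu>" and \<mu>: "sets \<mu> = sets borel"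
    and Z: "Z \<in> null_sets lborel"
  shows "\<phi> -` Z \<inter> U \<in> null_sets \<mu>"
proof -
  note ch = C1_atlas_chart[OF A]
  let ?R = "restrict_space \<mu> U"
  have sp: "space \<mu> = UNIV" using sets_eq_imp_space_eq[OF \<mu>] by simp
  have U: "U \<in> sets \<mu>" unfolding \<mu> using ch(1) by (rule borel_open)
  have spR: "space ?R = U" by (simp add: space_restrict_space sp)
  have "\<phi> \<in> borel_measurable (restrict_space borel U)"
    using ch(3) by (rule borel_measurable_continuous_on_restrict)
  then have \<phi>: "\<phi> \<in> borel_measurable ?R"
    using measurable_cong_sets[OF sets_restrict_space_cong[OF \<mu>] refl] by blast
  have "absolutely_continuous lborel (distr ?R borel \<phi>)"
    using ac A(2) unfolding ac_coordinate_measure_def model_measure_def by auto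
  then have "Z \<in> null_sets (distr ?R borel \<phi>)" using Z unfolding absolutely_continuous_def by blast
  then have Z': "Z \<in> sets borel" "emeasure (distr ?R borel \<phi>) Z = 0" by auto
  have "emeasure \<mu> (\<phi> -` Z \<inter> U) = emeasure ?R (\<phi> -` Z \<inter> U)"
    using U by (subst emeasure_restrict_space) (auto simp: sp)
  also have "\<dots> = 0" using Z'(2) emeasure_distr[OF \<phi> Z'(1)] by (simp add: spR)
  finally have "emeasure \<mu> (\<phi> -` Z \<inter> U) = 0" .
  moreover have "\<phi> -` Z \<inter> U \<in> sets ?R" using measurable_sets[OF \<phi> Z'(1)] by (simp add: spR)
  then have "\<phi> -` Z \<inter> U \<in> sets \<mu>" using U by (simp add: sets_restrict_space_iff sp)
  ultimately show ?thesis by auto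
qed

text \<open>Not being critical for a pair of partners means that their slopes differ in the chart.
  \<open>distinct_slopes_null\<close> confines this to a Lebesgue null set, and absolute continuity
  carries it back to \<mu>.\<close>

lemma noncritical_null:
  fixes A :: "('a::polish_space, 'e::euclidean_space) chart set" and c :: "'a \<times> 'b::polish_space \<Rightarrow> real"
  assumes A: "C1_atlas E A" and ac: "ac_coordinate_measure E A \<mu>" and \<mu>: "sets \<mu> = sets borel"
    and c: "continuous_on UNIV c" "x_derivative_locally_bounded A c"
    and S: "sigma_compact S" "cost_monotone c S"
  obtains Z where "Z \<in> null_sets \<mu>" "\<And>x y1 y2. (x, y1) \<in> S \<Longrightarrow> (x, y2) \<in> S \<Longrightarrow>
    \<not> critical_point A (\<lambda>x. c (x, y1) - c (x, y2)) x \<Longrightarrow> x \<in> Z"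
proof -
  define good where "good W \<longleftrightarrow> (\<exists>Z\<in>null_sets \<mu>. \<forall>x\<in>W. \<forall>y1 y2. (x, y1) \<in> S \<longrightarrow> (x, y2) \<in> S \<longrightarrow>
    \<not> critical_point A (\<lambda>x. c (x, y1) - c (x, y2)) x \<longrightarrow> x \<in> Z)" for W
  have good: "good W" if U: "(U, \<phi>) \<in> A" and W: "W \<subseteq> U"
    and D: "\<And>z y. z \<in> W \<Longrightarrow> \<exists>D. has_chart_derivative (\<lambda>x. c (x, y)) (U, \<phi>) z D" for U \<phi> W
  proof -
    note ch = C1_atlas_chart[OF A U]
    have "E = {0} \<or> E = UNIV" using A unfolding C1_atlas_def euclidean_model_def by auto
    then show ?thesis
    proof
      \<comment> \<open>The chart image is a single point, where the zero map is a derivative of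
        every function; so every point is critical and the empty set serves as exceptional
        set.\<close>
      assume E: "E = {0}"
      have "critical_point A f x" if "x \<in> W" for f :: "'a \<Rightarrow> real" and x
      proof -
        have x: "x \<in> U" using that W by auto
        moreover have "\<phi> ` U \<subseteq> {0}" using ch(2) unfolding E by (auto dest: openin_imp_subset)
        then have "\<phi> u = 0" if "u \<in> U" for u using that by blast
        ultimately have "\<phi> ` U = {\<phi> x}" by (auto simp: image_iff intro!: bexI[of _ x])
        then have "has_chart_derivative f (U, \<phi>) x (\<lambda>_. 0)"
          unfolding has_chart_derivative_def by (simp add: has_derivative_within_singleton_iff)
        then show ?thesis unfolding critical_point_def using U x by blast
      qed
      then show ?thesis unfolding good_def by (intro bexI[of _ "{}"]) auto
    next
      assume E: "E = UNIV"
      let ?q = "inv_into U \<phi>"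
      have G: "open (\<phi> ` U)" using ch(2) unfolding E by simp
      obtain Z where Z: "Z \<in> null_sets lborel" "\<forall>p\<in>\<phi> ` U. \<forall>y1 y2 D1 D2. (?q p, y1) \<in> S \<longrightarrow> (?q p, y2) \<in> S \<longrightarrow>
         ((\<lambda>p. c (?q p, y1)) has_derivative D1) (at p) \<longrightarrow> ((\<lambda>p. c (?q p, y2)) has_derivative D2) (at p) \<longrightarrow>
         D1 \<noteq> D2 \<longrightarrow> p \<in> Z"
        by (rule bexE[OF distinct_slopes_null[OF c(1) G ch(5) S]])
      show ?thesis unfolding good_def
      proof (intro bexI[of _ "\<phi> -` Z \<inter> U"] ballI allI impI)
        show "\<phi> -` Z \<inter> U \<in> null_sets \<mu>"
          using A ac unfolding E by (intro chart_vimage_null[OF _ U] \<mu> Z(1))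
        fix x y1 y2 assume x: "x \<in> W" and y: "(x, y1) \<in> S" "(x, y2) \<in> S"
          and nc: "\<not> critical_point A (\<lambda>x. c (x, y1) - c (x, y2)) x"
        have xU: "x \<in> U" using x W by auto
        have q: "?q (\<phi> x) = x" using ch(4) xU by simp
        obtain D1 where D1: "has_chart_derivative (\<lambda>x. c (x, y1)) (U, \<phi>) x D1" using D[OF x] by blast
        obtain D2 where D2: "has_chart_derivative (\<lambda>x. c (x, y2)) (U, \<phi>) x D2" using D[OF x] by blast
        have at: "at (\<phi> x) within \<phi> ` U = at (\<phi> x)" using G xU by (intro at_within_open) auto
        have D1': "((\<lambda>p. c (?q p, y1)) has_derivative D1) (at (\<phi> x))"
          and D2': "((\<lambda>p. c (?q p, y2)) has_derivative D2) (at (\<phi> x))"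
          using D1 D2 by (simp_all add: has_chart_derivative_def at comp_def)
        have "D1 \<noteq> D2"
        proof
          assume "D1 = D2"
          then have "((\<lambda>p. c (?q p, y1) - c (?q p, y2)) has_derivative (\<lambda>_. 0)) (at (\<phi> x))"
            using has_derivative_diff[OF D1' D2'] by simp
          then have "has_chart_derivative (\<lambda>x. c (x, y1) - c (x, y2)) (U, \<phi>) x (\<lambda>_. 0)"
            by (simp add: has_chart_derivative_def at comp_def)
          then show False using nc U xU unfolding critical_point_def by blast
        qed
        then have "\<phi> x \<in> Z" using Z(2)[rule_format, OF imageI[OF xU] _ _ D1' D2'] y q by simp
        then show "x \<in> \<phi> -` Z \<inter> U" using xU by simp
      qed
    qed
  qed
  \<comment> \<open>Around each point the local bound supplies one chart neighbourhood on which all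
    derivatives in \<open>x\<close> exist, so \<open>good\<close> holds locally. Lindelof leaves
    countably many null sets to unite.\<close>
  let ?F = "{W. open W \<and> good W}"
  have "\<exists>W\<in>?F. x \<in> W" for x
  proof -
    obtain ch where ch: "ch \<in> A" "case ch of (U, \<phi>) \<Rightarrow> \<exists>W K. open W \<and> x \<in> W \<and> W \<subseteq> U \<and>
        (\<forall>z\<in>W. \<forall>y. \<exists>D. has_chart_derivative (\<lambda>x. c (x, y)) (U, \<phi>) z D \<and> onorm D \<le> K)"
      by (rule bexE[OF c(2)[unfolded x_derivative_locally_bounded_def, THEN spec, of x]])
    obtain U \<phi> where U: "ch = (U, \<phi>)" by (rule prod.exhaust)
    obtain W K where *: "(U, \<phi>) \<in> A" "open W" "x \<in> W" "W \<subseteq> U"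
      "\<forall>z\<in>W. \<forall>y. \<exists>D. has_chart_derivative (\<lambda>x. c (x, y)) (U, \<phi>) z D \<and> onorm D \<le> K"
      using ch unfolding U prod.case by (elim exE conjE)
    then have "good W" by (intro good[OF *(1,4)]) blast
    then show ?thesis using * by blast
  qed
  then have "\<Union>?F = UNIV" by blast
  moreover obtain F' where F': "F' \<subseteq> ?F" "countable F'" "\<Union>F' = \<Union>?F"
    using Lindelof[of ?F] by blast
  ultimately have cover: "\<Union>F' = UNIV" by simp
  have "\<forall>W\<in>F'. good W" using F'(1) by blast
  from bchoice[OF this[unfolded good_def Bex_def]]
  obtain Z where Z: "\<forall>W\<in>F'. Z W \<in> null_sets \<mu> \<and> (\<forall>x\<in>W. \<forall>y1 y2. (x, y1) \<in> S \<longrightarrow> (x, y2) \<in> S \<longrightarrow>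
    \<not> critical_point A (\<lambda>x. c (x, y1) - c (x, y2)) x \<longrightarrow> x \<in> Z W)" ..
  show ?thesis
  proof (rule that)
    show "(\<Union>W\<in>F'. Z W) \<in> null_sets \<mu>" using F'(2) Z by (intro null_sets_UN') auto
    fix x y1 y2 assume *: "(x, y1) \<in> S" "(x, y2) \<in> S" "\<not> critical_point A (\<lambda>x. c (x, y1) - c (x, y2)) x"
    obtain W where W: "W \<in> F'" "x \<in> W" using cover by blast
    then have "x \<in> Z W" using Z[THEN bspec, OF W(1)] * by simp
    then show "x \<in> (\<Union>W\<in>F'. Z W)" using W by blast
  qed
qed

section \<open>The two-limb system\<close>

text \<open>
  If \<open>x\<close> minimises \<open>c (x, y1) - c (x, y2)\<close> then monotonicity turns every other partner of \<open>y1\<close>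
  into a second minimiser; if \<open>x\<close> is a maximiser, the same happens to \<open>y2\<close>.
\<close>

lemma cost_monotone_critical_limb_like:
  assumes S: "cost_monotone c S"
    and crit: "\<And>x y1 y2. (x, y1) \<in> S \<Longrightarrow> (x, y2) \<in> S \<Longrightarrow> critical_point A (\<lambda>x. c (x, y1) - c (x, y2)) x"
    and ext: "\<And>y1 y2. y1 \<noteq> y2 \<Longrightarrow> no_critical_points_save_extrema A (\<lambda>x. c (x, y1) - c (x, y2))"
  shows "limb_like S"
  unfolding limb_like_def
proof (intro allI Uniq_I)
  fix x y1 y2 assume y: "(x, y1) \<in> S \<and> y1 \<in> multi_partnered S" "(x, y2) \<in> S \<and> y2 \<in> multi_partnered S"
  show "y1 = y2"
  proof (rule ccontr)
    assume neq: "y1 \<noteq> y2"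
    let ?f = "\<lambda>x. c (x, y1) - c (x, y2)"
    have "\<exists>x1. x1 \<noteq> x \<and> (x1, y1) \<in> S" using y(1) by (intro multi_partnered_other_vertex) simp
    then obtain x1 where x1: "x1 \<noteq> x" "(x1, y1) \<in> S" by blast
    have "\<exists>x2. x2 \<noteq> x \<and> (x2, y2) \<in> S" using y(2) by (intro multi_partnered_other_vertex) simp
    then obtain x2 where x2: "x2 \<noteq> x" "(x2, y2) \<in> S" by blast
    \<comment> \<open>Monotonicity for the edges \<open>(x1, y1)\<close> and \<open>(x, y2)\<close>,
      rearranged; \<open>f2\<close> is the same for \<open>(x, y1)\<close> and
      \<open>(x2, y2)\<close>.\<close>
    have f1: "?f x1 \<le> ?f x" using cost_monotoneD[OF S x1(2), of x y2] y by simp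
    have f2: "?f x \<le> ?f x2" using cost_monotoneD[OF S _ x2(2), of x y1] y by simp
    note ext = ext[OF neq, unfolded no_critical_points_save_extrema_def]
    have "is_arg_min ?f (\<lambda>_. True) x \<or> is_arg_max ?f (\<lambda>_. True) x" using ext crit y by blast
    then show False
    proof
      assume min: "is_arg_min ?f (\<lambda>_. True) x"
      then have "is_arg_min ?f (\<lambda>_. True) x1" using f1 unfolding is_arg_min_linorder by (meson order_trans)
      then show False using ext min x1(1) by (metis (no_types, lifting) Uniq_D)
    next
      assume max: "is_arg_max ?f (\<lambda>_. True) x"
      then have "is_arg_max ?f (\<lambda>_. True) x2" using f2 unfolding is_arg_max_linorder by (meson order_trans)
      then show False using ext max x2(1) by (metis (no_types, lifting) Uniq_D)
    qed
  qed
qed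

theorem theorem4p1:
  fixes E :: "'e::euclidean_space set" and A :: "('a::polish_space, 'e) chart set"
    and F :: "'f::euclidean_space set" and B :: "('b::polish_space, 'f) chart set"
    and \<mu> :: "'a measure" and \<nu> :: "'b measure"
    and c :: "'a \<times> 'b \<Rightarrow> real"
  assumes "C1_atlas E A" and "C1_atlas F B"
    and "prob_space \<mu>" and "sets \<mu> = sets borel"
    and "prob_space \<nu>" and "sets \<nu> = sets borel"
    and "C1_function (product_atlas A B) c" and "bounded (range c)"
    and "\<And>y1 y2. y1 \<noteq> y2 \<Longrightarrow> no_critical_points_save_extrema A (\<lambda>x. c (x, y1) - c (x, y2))"
    and "x_derivative_locally_bounded A c"
    and "ac_coordinate_measure E A \<mu>"
  shows "(\<exists>!\<gamma>. is_arg_min (\<lambda>\<gamma>. LINT p|\<gamma>. c p) (\<lambda>\<gamma>. \<gamma> \<in> couplings \<mu> \<nu>) \<gamma>) \<and>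
    (\<forall>\<gamma>. is_arg_min (\<lambda>\<gamma>. LINT p|\<gamma>. c p) (\<lambda>\<gamma>. \<gamma> \<in> couplings \<mu> \<nu>) \<gamma> \<longrightarrow>
       (\<exists>S. numbered_limb_system 2 S \<and> vanishes_outside \<gamma> S))"
proof -
  let ?opt = "is_arg_min (\<lambda>\<gamma>. LINT p|\<gamma>. c p) (\<lambda>\<gamma>. \<gamma> \<in> couplings \<mu> \<nu>)"
  have c: "continuous_on UNIV c" by (rule C1_function_imp_continuous[OF assms(1,2,7)])
  have limbs: "\<exists>S. sigma_compact S \<and> limb_like S \<and> emeasure \<gamma> (- S) = 0" if "?opt \<gamma>" for \<gamma>
  proof -
    have \<gamma>: "\<gamma> \<in> couplings \<mu> \<nu>" "\<And>\<delta>. \<delta> \<in> couplings \<mu> \<nu> \<Longrightarrow> (LINT p|\<gamma>. c p) \<le> (LINT p|\<delta>. c p)"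
      using that by (auto simp: is_arg_min_linorder)
    note s = couplings_space[OF \<gamma>(1)]
    interpret prob_space \<gamma> by (rule couplings_prob_space[OF \<gamma>(1) assms(3)])
    have fin: "finite_measure \<gamma>" by (rule finite_measure_axioms)
    obtain T where T: "closed T" "cost_monotone c T" "emeasure \<gamma> (- T) = 0"
      by (rule optimal_cost_monotone[OF \<gamma>(1) assms(3) c assms(8) \<gamma>(2)])
    \<comment> \<open>The slope argument decomposes the carrier into compact pieces, so the closed
      set \<open>T\<close> is first cut down to a sigma-compact one.\<close>
    obtain S0 where S0: "S0 \<subseteq> T" "sigma_compact S0" "emeasure \<gamma> (T - S0) = 0"
      by (rule ex_sigma_compact_full_measure[OF fin s(1) borel_closed[OF T(1)]])
    obtain Z where Z: "Z \<in> null_sets \<mu>" "\<And>x y1 y2. (x, y1) \<in> S0 \<Longrightarrow> (x, y2) \<in> S0 \<Longrightarrow>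
        \<not> critical_point A (\<lambda>x. c (x, y1) - c (x, y2)) x \<Longrightarrow> x \<in> Z"
      by (rule noncritical_null[OF assms(1,11,4) c assms(10) S0(2) cost_monotone_subset[OF T(2) S0(1)]]) blast
    have Zb: "Z \<in> sets borel" using Z(1) assms(4) by auto
    then have Zn: "emeasure \<gamma> (Z \<times> UNIV) = 0" using couplings_emeasure(1)[OF \<gamma>(1)] Z(1) by auto
    have ZU: "Z \<times> UNIV \<in> sets borel" using Zb by (intro borel_Times) auto
    have S1: "S0 - Z \<times> UNIV \<in> sets borel" using sigma_compact_borel[OF S0(2)] ZU by (rule sets.Diff)
    \<comment> \<open>Deleting the Borel strip over \<open>Z\<close> may spoil sigma-compactness, so
      the set is cut down a second time. No point over \<open>Z\<close> can reappear in a
      subset.\<close>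
    obtain S where S: "S \<subseteq> S0 - Z \<times> UNIV" "sigma_compact S" "emeasure \<gamma> (S0 - Z \<times> UNIV - S) = 0"
      by (rule ex_sigma_compact_full_measure[OF fin s(1) S1])
    have "cost_monotone c S" using S(1) S0(1) by (intro cost_monotone_subset[OF T(2)]) auto
    moreover have "critical_point A (\<lambda>x. c (x, y1) - c (x, y2)) x" if "(x, y1) \<in> S" "(x, y2) \<in> S" for x y1 y2
      using Z(2)[of x y1 y2] that S(1) by blast
    ultimately have "limb_like S" by (rule cost_monotone_critical_limb_like[OF _ _ assms(9)])
    moreover have "emeasure \<gamma> (- S) = 0"
    proof -
      have n: "- T \<in> null_sets \<gamma>" "T - S0 \<in> null_sets \<gamma>" "Z \<times> UNIV \<in> null_sets \<gamma>" "S0 - Z \<times> UNIV - S \<in> null_sets \<gamma>"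
        using T S0 Zn ZU S S1 sigma_compact_borel[OF S0(2)] sigma_compact_borel[OF S(2)]
        by (simp_all add: null_sets_def s sets.Diff borel_comp)
      have sub: "- S \<subseteq> (- T \<union> (T - S0)) \<union> (Z \<times> UNIV \<union> (S0 - Z \<times> UNIV - S))" by blast
      have "(- T \<union> (T - S0)) \<union> (Z \<times> UNIV \<union> (S0 - Z \<times> UNIV - S)) \<in> null_sets \<gamma>"
        by (intro null_sets.Un n)
      moreover have "- S \<in> sets \<gamma>" unfolding s using sigma_compact_borel[OF S(2)] by (rule borel_comp)
      ultimately have "- S \<in> null_sets \<gamma>" using sub by (rule null_sets_subset)
      then show ?thesis by auto
    qed
    ultimately show ?thesis using S(2) by blast
  qed
  have "\<exists>\<gamma>. ?opt \<gamma>"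
    by (rule ex_optimal_coupling[OF assms(3-6) c assms(8)]) (auto simp: is_arg_min_linorder)
  moreover have "\<gamma> = \<gamma>'" if "?opt \<gamma>" "?opt \<gamma>'" for \<gamma> \<gamma>'
  proof -
    have \<gamma>: "\<gamma> \<in> couplings \<mu> \<nu>" "\<gamma>' \<in> couplings \<mu> \<nu>" "(LINT p|\<gamma>. c p) = (LINT p|\<gamma>'. c p)"
      using that by (auto simp: is_arg_min_linorder intro!: antisym)
    obtain \<delta> where \<delta>: "\<delta> \<in> couplings \<mu> \<nu>" "2 * (LINT p|\<delta>. c p) = (LINT p|\<gamma>. c p) + (LINT p|\<gamma>'. c p)"
      "\<And>A. A \<in> sets borel \<Longrightarrow> emeasure \<delta> A = 0 \<Longrightarrow> emeasure \<gamma> A = 0 \<and> emeasure \<gamma>' A = 0"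
      by (rule ex_average_coupling[OF \<gamma>(1,2) assms(3) c assms(8)]) blast
    have "(LINT p|\<delta>. c p) = (LINT p|\<gamma>. c p)" using \<delta>(2) \<gamma>(3) by simp
    then have "?opt \<delta>" using that(1) \<delta>(1) by (simp add: is_arg_min_linorder)
    from limbs[OF this] obtain S where S: "sigma_compact S" "limb_like S" "emeasure \<delta> (- S) = 0" by blast
    have "- S \<in> sets borel" using sigma_compact_borel[OF S(1)] by (rule borel_comp)
    from \<delta>(3)[OF this S(3)] show ?thesis
      using coupling_on_limbs_unique[OF \<gamma>(1,2) assms(3) S(1,2)] by blast
  qed
  ultimately have "\<exists>!\<gamma>. ?opt \<gamma>" by blast
  moreover have "\<exists>S. numbered_limb_system 2 S \<and> vanishes_outside \<gamma> S" if \<gamma>: "?opt \<gamma>" for \<gamma>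
  proof -
    obtain S where S: "sigma_compact S" "limb_like S" "emeasure \<gamma> (- S) = 0" using limbs[OF \<gamma>] by blast
    have "\<gamma> \<in> couplings \<mu> \<nu>" using \<gamma> by (simp add: is_arg_min_linorder)
    note s = couplings_space[OF this]
    have "- S \<in> sets \<gamma>" unfolding s using sigma_compact_borel[OF S(1)] by (rule borel_comp)
    then have "outer_measure_of \<gamma> (- S) = 0" using S(3) by (simp add: outer_measure_of_eq)
    then have "vanishes_outside \<gamma> S" unfolding vanishes_outside_def s by (simp add: Compl_eq_Diff_UNIV)
    then show ?thesis using limb_like_numbered_limb_system[OF S(2)] by blast
  qed
  ultimately show ?thesis by blast
qed

end
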